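(* Let $p,q\ge 0$ be integers with $p+q\ge 1$, let $V=\mathbb{R}^{p+q}$ with the quadratic form $P(v)=\sum_{i=1}^p v_i^2-\sum_{j=1}^q v_{p+j}^2$, and let $W=\mathbb{R}^m$. Then the self-dual quadratic mappings $Q:W\to V$ are in one-to-one correspondence with the representations $\rho:C_p\otimes C_q\to M(m;\mathbb{R})$ such that $\rho(V)\subset \mathrm{Sym}(m;\mathbb{R})$. The correspondence is $Q(w)=({}^tw\,S_1\,w,\ldots,{}^tw\,S_{p+q}\,w)$ with $S_i=\rho(e_i)$ for $1\le i\le p+q$.
   Context: $C_r$ denotes the real Clifford algebra of the positive definite quadratic form in $r$ variables, i.e. the unital associative $\mathbb{R}$-algebra generated by $e_1,\dots,e_r$ with $e_i^2=1$ and $e_ie_j=-e_je_i$ for $i\neq j$ ($C_0=\mathbb{R}$). $C_p\otimes C_q$ is the ordinary (ungraded) tensor product over $\mathbb{R}$; $e_1,\dots,e_p$ denote the generators of $C_p$ (identified with $e_i\otimes 1$) and $e_{p+1},\dots,e_{p+q}$ the generators of $C_q$ (identified with $1\otimes e_{p+j}$). $V$ is identified with the span of $e_1,\dots,e_{p+q}$ in $C_p\otimes C_q$ (the standard basis), and with its own dual via the standard inner product. Representations are unital algebra homomorphisms. $\mathrm{Sym}(m;\mathbb{R})$ is the space of real symmetric matrices of size $m$. A quadratic mapping $Q:W=\mathbb{R}^m\to V$ is a map of the form $Q(w)=({}^tw\,S_1\,w,\dots,{}^tw\,S_{p+q}\,w)$ with $S_1,\dots,S_{p+q}\in\mathrm{Sym}(m;\mathbb{R})$.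 Put $S(v)=\sum_{i=1}^{p+q}v_iS_i$, $\Omega=\{v\in V: P(v)\ne 0\}$ and let $\phi:\Omega\to\Omega$ be $\phi(v)=\frac12\,\mathrm{grad}\log P(v)=\frac1{P(v)}(v_1,\dots,v_p,-v_{p+1},\dots,-v_{p+q})$. The mapping $Q$ is called self-dual if $S(v)S(\phi(v))=1_m$ for all $v\in\Omega$. *)

theory Defs
  imports Complex_Main "HOL-Algebra.QuotRing" "Jordan_Normal_Form.Matrix"
begin

section \<open>Real algebras on explicit carriers\<close>

text \<open>
  Unital associative real algebras are records of type \<open>(real, 'a) module\<close>, which carry a ring
  structure and a scalar multiplication. In particular \<open>module_mat TYPE(real) m m\<close> is the algebra
  \<open>M(m;\<real>)\<close>. Homomorphisms are taken extensional, so that equality of representations is equality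
  on the carrier.
\<close>

definition alg_hom :: "(real, 'a) module \<Rightarrow> (real, 'b) module \<Rightarrow> ('a \<Rightarrow> 'b) set" where
  "alg_hom A B =
     {h \<in> Ring.ring_hom A B. h \<in> extensional (carrier A) \<and>
        (\<forall>c. \<forall>x\<in>carrier A. h (c \<odot>\<^bsub>A\<^esub> x) = c \<odot>\<^bsub>B\<^esub> h x)}"

text \<open>The monoid algebra \<open>\<real>[M]\<close>: finitely supported functions on \<open>M\<close> under convolution.\<close>

definition supp :: "('a \<Rightarrow> real) \<Rightarrow> 'a set" where
  "supp f = {x. f x \<noteq> 0}"

definition monoid_algebra :: "('a, 'm) monoid_scheme \<Rightarrow> (real, 'a \<Rightarrow> real) module" where
  "monoid_algebra M =
     \<lparr>carrier = {f. finite (supp f) \<and> supp f \<subseteq> carrier M},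
      monoid.mult = (\<lambda>f g z. \<Sum>x\<in>supp f. \<Sum>y\<in>supp g. if x \<otimes>\<^bsub>M\<^esub> y = z then f x * g y else 0),
      monoid.one = (\<lambda>z. if z = \<one>\<^bsub>M\<^esub> then 1 else 0),
      ring.zero = (\<lambda>z. 0),
      ring.add = (\<lambda>f g z. f z + g z),
      module.smult = (\<lambda>c f z. c * f z)\<rparr>"

definition basis_elt :: "'a \<Rightarrow> 'a \<Rightarrow> real" where
  "basis_elt x = (\<lambda>z. if z = x then 1 else 0)"

text \<open>
  The quotient of a real algebra by a two-sided ideal: the ring \<open>A Quot I\<close> with the induced scalar
  multiplication. The union over representatives mirrors \<^const>\<open>rcoset_mult\<close> (and gives \<open>I\<close>,
  not \<open>{0}\<close>, for the scalar 0).
\<close>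

definition quot_alg :: "(real, 'a) module \<Rightarrow> 'a set \<Rightarrow> (real, 'a set) module" where
  "quot_alg A I = ring.extend (A Quot I)
     (module.fields (\<lambda>c X. \<Union>x\<in>X. I +>\<^bsub>A\<^esub> (c \<odot>\<^bsub>A\<^esub> x)))"

section \<open>Clifford algebras and tensor products\<close>

definition free_monoid :: "'a set \<Rightarrow> 'a list monoid" where
  "free_monoid X = \<lparr>carrier = lists X, monoid.mult = (@), monoid.one = []\<rparr>"

text \<open>
  The real Clifford algebra of the positive definite form in \<open>r\<close> variables: the free unital
  associative algebra on \<open>r\<close> generators modulo the ideal of relations. Generators are
  numbered from \<open>0\<close>.
\<close>

abbreviation free_alg :: "nat \<Rightarrow> (real, nat list \<Rightarrow> real) module" where
  "free_alg r \<equiv> monoid_algebra (free_monoid {..<r})"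

definition clifford_rels :: "nat \<Rightarrow> (nat list \<Rightarrow> real) set" where
  "clifford_rels r =
     (let F = free_alg r; x = (\<lambda>i. basis_elt [i]) in
        {x i \<otimes>\<^bsub>F\<^esub> x i \<ominus>\<^bsub>F\<^esub> \<one>\<^bsub>F\<^esub> | i. i < r} \<union>
        {x i \<otimes>\<^bsub>F\<^esub> x j \<oplus>\<^bsub>F\<^esub> x j \<otimes>\<^bsub>F\<^esub> x i | i j. i < r \<and> j < r \<and> i \<noteq> j})"

definition clifford_ideal :: "nat \<Rightarrow> (nat list \<Rightarrow> real) set" where
  "clifford_ideal r = Idl\<^bsub>free_alg r\<^esub> (clifford_rels r)"

definition clifford :: "nat \<Rightarrow> (real, (nat list \<Rightarrow> real) set) module" where
  "clifford r = quot_alg (free_alg r) (clifford_ideal r)"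

definition clifford_gen :: "nat \<Rightarrow> nat \<Rightarrow> (nat list \<Rightarrow> real) set" where
  "clifford_gen r i = clifford_ideal r +>\<^bsub>free_alg r\<^esub> basis_elt [i]"

text \<open>
  The (ungraded) tensor product over \<open>\<real>\<close>: the free vector space on \<open>A \<times> B\<close> modulo the
  bilinearity relations, with \<open>(a \<otimes> b)(a' \<otimes> b') = aa' \<otimes> bb'\<close>. The free vector space with this
  product is the monoid algebra of the multiplicative monoid \<open>A \<times>\<times> B\<close>. The linear span of the
  relations is stable under left and right multiplication by basis elements, so it
  coincides with the ideal used here.
\<close>

definition tensor_rels :: "(real, 'a) module \<Rightarrow> (real, 'b) module \<Rightarrow> ('a \<times> 'b \<Rightarrow> real) set" where
  "tensor_rels A B =
     (let F = monoid_algebra (A \<times>\<times> B); t = (\<lambda>a b. basis_elt (a, b)) in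
        {t (a \<oplus>\<^bsub>A\<^esub> a') b \<ominus>\<^bsub>F\<^esub> (t a b \<oplus>\<^bsub>F\<^esub> t a' b) | a a' b.
           a \<in> carrier A \<and> a' \<in> carrier A \<and> b \<in> carrier B} \<union>
        {t a (b \<oplus>\<^bsub>B\<^esub> b') \<ominus>\<^bsub>F\<^esub> (t a b \<oplus>\<^bsub>F\<^esub> t a b') | a b b'.
           a \<in> carrier A \<and> b \<in> carrier B \<and> b' \<in> carrier B} \<union>
        {t (c \<odot>\<^bsub>A\<^esub> a) b \<ominus>\<^bsub>F\<^esub> c \<odot>\<^bsub>F\<^esub> t a b | c a b. a \<in> carrier A \<and> b \<in> carrier B} \<union>
        {t a (c \<odot>\<^bsub>B\<^esub> b) \<ominus>\<^bsub>F\<^esub> c \<odot>\<^bsub>F\<^esub> t a b | c a b. a \<in> carrier A \<and> b \<in> carrier B})"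

definition tensor_ideal :: "(real, 'a) module \<Rightarrow> (real, 'b) module \<Rightarrow> ('a \<times> 'b \<Rightarrow> real) set" where
  "tensor_ideal A B = Idl\<^bsub>monoid_algebra (A \<times>\<times> B)\<^esub> (tensor_rels A B)"

definition tensor_alg ::
    "(real, 'a) module \<Rightarrow> (real, 'b) module \<Rightarrow> (real, ('a \<times> 'b \<Rightarrow> real) set) module" where
  "tensor_alg A B = quot_alg (monoid_algebra (A \<times>\<times> B)) (tensor_ideal A B)"

definition pure_tensor ::
    "(real, 'a) module \<Rightarrow> (real, 'b) module \<Rightarrow> 'a \<Rightarrow> 'b \<Rightarrow> ('a \<times> 'b \<Rightarrow> real) set" where
  "pure_tensor A B a b = tensor_ideal A B +>\<^bsub>monoid_algebra (A \<times>\<times> B)\<^esub> basis_elt (a, b)"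

definition CC :: "nat \<Rightarrow> nat \<Rightarrow>
    (real, ((nat list \<Rightarrow> real) set \<times> (nat list \<Rightarrow> real) set \<Rightarrow> real) set) module" where
  "CC p q = tensor_alg (clifford p) (clifford q)"

text \<open>\<open>gen p q i\<close> is the generator \<open>e\<^bsub>i+1\<^esub>\<close>: \<open>e\<^bsub>i+1\<^esub> \<otimes> 1\<close> for \<open>i < p\<close>, and \<open>1 \<otimes> e\<^bsub>p+j+1\<^esub>\<close> for \<open>i = p + j\<close>.\<close>

definition gen :: "nat \<Rightarrow> nat \<Rightarrow> nat \<Rightarrow>
    ((nat list \<Rightarrow> real) set \<times> (nat list \<Rightarrow> real) set \<Rightarrow> real) set" where
  "gen p q i =
     (if i < p
      then pure_tensor (clifford p) (clifford q) (clifford_gen p i) \<one>\<^bsub>clifford q\<^esub>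
      else pure_tensor (clifford p) (clifford q) \<one>\<^bsub>clifford p\<^esub> (clifford_gen q (i - p)))"

text \<open>The identification of \<open>V = \<real>\<^bsup>p+q\<^esup>\<close> with the span of the generators.\<close>

definition embed_V :: "nat \<Rightarrow> nat \<Rightarrow> real vec \<Rightarrow>
    ((nat list \<Rightarrow> real) set \<times> (nat list \<Rightarrow> real) set \<Rightarrow> real) set" where
  "embed_V p q v = (\<Oplus>\<^bsub>CC p q\<^esub>i\<in>{..<p+q}. (v $ i) \<odot>\<^bsub>CC p q\<^esub> gen p q i)"

definition Sym :: "nat \<Rightarrow> real mat set" where
  "Sym m = {A \<in> carrier_mat m m. transpose_mat A = A}"

definition sym_reps :: "nat \<Rightarrow> nat \<Rightarrow> nat \<Rightarrow>
    (((nat list \<Rightarrow> real) set \<times> (nat list \<Rightarrow> real) set \<Rightarrow> real) set \<Rightarrow> real mat) set" where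
  "sym_reps p q m =
     {\<rho> \<in> alg_hom (CC p q) (module_mat TYPE(real) m m).
        \<rho> ` embed_V p q ` carrier_vec (p + q) \<subseteq> Sym m}"

section \<open>Self-dual quadratic mappings\<close>

definition Pform :: "nat \<Rightarrow> nat \<Rightarrow> real vec \<Rightarrow> real" where
  "Pform p q v = (\<Sum>i<p. (v $ i)^2) - (\<Sum>j<q. (v $ (p + j))^2)"

definition Omega :: "nat \<Rightarrow> nat \<Rightarrow> real vec set" where
  "Omega p q = {v \<in> carrier_vec (p + q). Pform p q v \<noteq> 0}"

definition phi :: "nat \<Rightarrow> nat \<Rightarrow> real vec \<Rightarrow> real vec" where
  "phi p q v = vec (p + q) (\<lambda>i. (if i < p then v $ i else - (v $ i)) / Pform p q v)"

text \<open>
  Mappings \<open>W \<rightarrow> V\<close> are extensional on \<open>carrier_vec m\<close>. Families \<open>S\<^bsub>1\<^esub>, \<dots>, S\<^bsub>n\<^esub>\<close> of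
  matrices are functions on \<open>nat\<close> of which only the values at indices below \<open>n\<close> matter.
\<close>

definition quad_map :: "nat \<Rightarrow> nat \<Rightarrow> (nat \<Rightarrow> real mat) \<Rightarrow> real vec \<Rightarrow> real vec" where
  "quad_map n m S = (\<lambda>w\<in>carrier_vec m. vec n (\<lambda>i. w \<bullet> (S i *\<^sub>v w)))"

definition quadratic_mappings :: "nat \<Rightarrow> nat \<Rightarrow> (real vec \<Rightarrow> real vec) set" where
  "quadratic_mappings n m = {quad_map n m S | S. \<forall>i<n. S i \<in> Sym m}"

definition lin_comb :: "nat \<Rightarrow> nat \<Rightarrow> (nat \<Rightarrow> real mat) \<Rightarrow> real vec \<Rightarrow> real mat" where
  "lin_comb n m S v = mat m m (\<lambda>(j, k). \<Sum>i<n. v $ i * S i $$ (j, k))"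

text \<open>
  By polarization, \<open>Q\<close> determines the symmetric matrices \<open>S\<^bsub>i\<^esub>\<close> with \<open>i < p + q\<close>; see
  \<open>quad_map_inject\<close> below. The existential quantifier therefore just names them.
\<close>

definition self_dual :: "nat \<Rightarrow> nat \<Rightarrow> nat \<Rightarrow> (real vec \<Rightarrow> real vec) \<Rightarrow> bool" where
  "self_dual p q m Q \<longleftrightarrow>
     (\<exists>S. (\<forall>i<p+q. S i \<in> Sym m) \<and> Q = quad_map (p + q) m S \<and>
        (\<forall>v\<in>Omega p q.
           lin_comb (p + q) m S v * lin_comb (p + q) m S (phi p q v) = 1\<^sub>m m))"

section \<open>Basic facts about the definitions\<close>

text \<open>
  The algebras above are rings, so that \<^const>\<open>genideal\<close> and \<^const>\<open>FactRing\<close> have their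
  intended meaning, and the generators of the Clifford algebra satisfy its relations.
\<close>

lemma monoid_algebra_mult:
  assumes "finite X" "supp f \<subseteq> X" "finite Y" "supp g \<subseteq> Y"
  shows "(f \<otimes>\<^bsub>monoid_algebra M\<^esub> g) z =
    (\<Sum>x\<in>X. \<Sum>y\<in>Y. if x \<otimes>\<^bsub>M\<^esub> y = z then f x * g y else 0)"
proof -
  have "(\<Sum>y\<in>supp g. if x \<otimes>\<^bsub>M\<^esub> y = z then f x * g y else 0) =
      (\<Sum>y\<in>Y. if x \<otimes>\<^bsub>M\<^esub> y = z then f x * g y else 0)" for x
    using assms by (intro sum.mono_neutral_left) (auto simp: supp_def)
  then have "(f \<otimes>\<^bsub>monoid_algebra M\<^esub> g) z =
      (\<Sum>x\<in>supp f. \<Sum>y\<in>Y. if x \<otimes>\<^bsub>M\<^esub> y = z then f x * g y else 0)"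
    by (simp add: monoid_algebra_def)
  also have "\<dots> = (\<Sum>x\<in>X. \<Sum>y\<in>Y. if x \<otimes>\<^bsub>M\<^esub> y = z then f x * g y else 0)"
  proof (rule sum.mono_neutral_left)
    show "\<forall>x\<in>X - supp f. (\<Sum>y\<in>Y. if x \<otimes>\<^bsub>M\<^esub> y = z then f x * g y else 0) = 0"
      by (intro ballI sum.neutral) (simp add: supp_def)
  qed (use assms in auto)
  finally show ?thesis .
qed

lemma supp_monoid_algebra_mult:
  "supp (f \<otimes>\<^bsub>monoid_algebra M\<^esub> g) \<subseteq> (\<lambda>(x, y). x \<otimes>\<^bsub>M\<^esub> y) ` (supp f \<times> supp g)"
proof
  fix z assume "z \<in> supp (f \<otimes>\<^bsub>monoid_algebra M\<^esub> g)"
  then have "(\<Sum>x\<in>supp f. \<Sum>y\<in>supp g. if x \<otimes>\<^bsub>M\<^esub> y = z then f x * g y else 0) \<noteq> 0"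
    by (simp add: supp_def[of "f \<otimes>\<^bsub>monoid_algebra M\<^esub> g"]) (simp add: monoid_algebra_def)
  then obtain x y where "x \<in> supp f" "y \<in> supp g"
      "(if x \<otimes>\<^bsub>M\<^esub> y = z then f x * g y else 0) \<noteq> 0"
    by (elim sum.not_neutral_contains_not_neutral)
  then have "x \<in> supp f" "y \<in> supp g" "x \<otimes>\<^bsub>M\<^esub> y = z" by (auto split: if_splits)
  then show "z \<in> (\<lambda>(x, y). x \<otimes>\<^bsub>M\<^esub> y) ` (supp f \<times> supp g)" by force
qed

lemma ring_monoid_algebra:
  assumes "monoid M"
  shows "ring (monoid_algebra M)"
proof -
  interpret M: monoid M by fact
  let ?R = "monoid_algebra M"
  have carr: "f \<in> carrier ?R \<longleftrightarrow> finite (supp f) \<and> supp f \<subseteq> carrier M" for f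
    by (simp add: monoid_algebra_def)
  have add: "f \<oplus>\<^bsub>?R\<^esub> g = (\<lambda>z. f z + g z)" for f g by (simp add: monoid_algebra_def)
  have zero: "\<zero>\<^bsub>?R\<^esub> = (\<lambda>z. 0)" by (simp add: monoid_algebra_def)
  have one: "\<one>\<^bsub>?R\<^esub> = (\<lambda>z. if z = \<one>\<^bsub>M\<^esub> then 1 else 0)" by (simp add: monoid_algebra_def)
  have supp_add: "supp (\<lambda>z. f z + g z) \<subseteq> supp f \<union> supp g" for f g :: "'a \<Rightarrow> real"
    by (auto simp: supp_def)
  have add_cl: "f \<oplus>\<^bsub>?R\<^esub> g \<in> carrier ?R" if "f \<in> carrier ?R" "g \<in> carrier ?R" for f g
    using that supp_add[of f g] unfolding carr add by (meson finite_UnI finite_subset le_sup_iff order_trans Un_least)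
  have mult_cl: "f \<otimes>\<^bsub>?R\<^esub> g \<in> carrier ?R" if "f \<in> carrier ?R" "g \<in> carrier ?R" for f g
  proof -
    have "finite ((\<lambda>(x, y). x \<otimes>\<^bsub>M\<^esub> y) ` (supp f \<times> supp g))"
      using that by (auto simp: carr)
    moreover have "(\<lambda>(x, y). x \<otimes>\<^bsub>M\<^esub> y) ` (supp f \<times> supp g) \<subseteq> carrier M"
      using that by (auto simp: carr)
    ultimately show ?thesis
      using supp_monoid_algebra_mult[where M = M and f = f and g = g] unfolding carr
      by (meson finite_subset order_trans)
  qed
  have one_cl: "\<one>\<^bsub>?R\<^esub> \<in> carrier ?R"
    by (auto simp: carr one supp_def)
  have ab: "abelian_group ?R"
  proof (rule abelian_groupI)
    fix f assume f: "f \<in> carrier ?R"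
    have "supp (\<lambda>z. - f z) = supp f" by (auto simp: supp_def)
    then have "(\<lambda>z. - f z) \<in> carrier ?R" using f by (simp add: carr)
    then show "\<exists>g\<in>carrier ?R. g \<oplus>\<^bsub>?R\<^esub> f = \<zero>\<^bsub>?R\<^esub>"
      by (intro bexI[of _ "\<lambda>z. - f z"]) (simp_all add: add zero)
  qed (use add_cl in \<open>auto simp: add zero carr supp_def algebra_simps\<close>)
  have assoc: "(f \<otimes>\<^bsub>?R\<^esub> g) \<otimes>\<^bsub>?R\<^esub> h = f \<otimes>\<^bsub>?R\<^esub> (g \<otimes>\<^bsub>?R\<^esub> h)"
    if f: "f \<in> carrier ?R" and g: "g \<in> carrier ?R" and h: "h \<in> carrier ?R" for f g h
  proof
    fix z
    let ?F = "supp f" and ?G = "supp g" and ?H = "supp h"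
    let ?U = "(\<lambda>(x, y). x \<otimes>\<^bsub>M\<^esub> y) ` (?F \<times> ?G)" and ?V = "(\<lambda>(x, y). x \<otimes>\<^bsub>M\<^esub> y) ` (?G \<times> ?H)"
    have fin: "finite ?F" "finite ?G" "finite ?H" and finU: "finite ?U" and finV: "finite ?V"
      using f g h by (auto simp: carr)
    have pull1: "(if b then (\<Sum>x\<in>A. \<Sum>y\<in>B. if p x y = u then k x y else 0) * c else 0) =
        (\<Sum>x\<in>A. \<Sum>y\<in>B. if u = p x y then (if b then k x y * c else 0) else 0)"
      for b c and A B :: "'a set" and p :: "'a \<Rightarrow> 'a \<Rightarrow> 'a" and u and k :: "'a \<Rightarrow> 'a \<Rightarrow> real"
      by (cases b) (simp_all add: sum_distrib_right if_distrib[of "\<lambda>r. r * c"] eq_commute[of u] cong: if_cong)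
    have pull2: "(if b then c * (\<Sum>x\<in>A. \<Sum>y\<in>B. if p x y = u then k x y else 0) else 0) =
        (\<Sum>x\<in>A. \<Sum>y\<in>B. if u = p x y then (if b then c * k x y else 0) else 0)"
      for b c and A B :: "'a set" and p :: "'a \<Rightarrow> 'a \<Rightarrow> 'a" and u and k :: "'a \<Rightarrow> 'a \<Rightarrow> real"
      by (cases b) (simp_all add: sum_distrib_left if_distrib[of "\<lambda>r. c * r"] eq_commute[of u] cong: if_cong)
    have "((f \<otimes>\<^bsub>?R\<^esub> g) \<otimes>\<^bsub>?R\<^esub> h) z =
        (\<Sum>u\<in>?U. \<Sum>w\<in>?H. if u \<otimes>\<^bsub>M\<^esub> w = z then (f \<otimes>\<^bsub>?R\<^esub> g) u * h w else 0)"
      by (rule monoid_algebra_mult[OF finU supp_monoid_algebra_mult fin(3) order_refl])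
    also have "\<dots> = (\<Sum>u\<in>?U. \<Sum>w\<in>?H. \<Sum>x\<in>?F. \<Sum>y\<in>?G.
        if u = x \<otimes>\<^bsub>M\<^esub> y then (if u \<otimes>\<^bsub>M\<^esub> w = z then f x * g y * h w else 0) else 0)"
      unfolding monoid_algebra_mult[OF fin(1) order_refl fin(2) order_refl]
      by (intro sum.cong refl) (rule pull1)
    also have "\<dots> = (\<Sum>w\<in>?H. \<Sum>x\<in>?F. \<Sum>y\<in>?G. \<Sum>u\<in>?U.
        if u = x \<otimes>\<^bsub>M\<^esub> y then (if u \<otimes>\<^bsub>M\<^esub> w = z then f x * g y * h w else 0) else 0)"
      by (simp only: sum.swap[of _ _ ?U])
    also have "\<dots> = (\<Sum>w\<in>?H. \<Sum>x\<in>?F. \<Sum>y\<in>?G.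
        if (x \<otimes>\<^bsub>M\<^esub> y) \<otimes>\<^bsub>M\<^esub> w = z then f x * g y * h w else 0)"
      by (intro sum.cong refl, subst sum.delta[OF finU]) force
    also have "\<dots> = (\<Sum>x\<in>?F. \<Sum>y\<in>?G. \<Sum>w\<in>?H.
        if (x \<otimes>\<^bsub>M\<^esub> y) \<otimes>\<^bsub>M\<^esub> w = z then f x * g y * h w else 0)"
      by (simp only: sum.swap[of _ _ ?H])
    also have "\<dots> = (\<Sum>x\<in>?F. \<Sum>y\<in>?G. \<Sum>w\<in>?H.
        if x \<otimes>\<^bsub>M\<^esub> (y \<otimes>\<^bsub>M\<^esub> w) = z then f x * (g y * h w) else 0)"
      using f g h
      by (intro sum.cong refl) (auto simp: carr subset_iff M.m_assoc algebra_simps)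
    finally have 1: "((f \<otimes>\<^bsub>?R\<^esub> g) \<otimes>\<^bsub>?R\<^esub> h) z = \<dots>" .
    have "(f \<otimes>\<^bsub>?R\<^esub> (g \<otimes>\<^bsub>?R\<^esub> h)) z =
        (\<Sum>x\<in>?F. \<Sum>v\<in>?V. if x \<otimes>\<^bsub>M\<^esub> v = z then f x * (g \<otimes>\<^bsub>?R\<^esub> h) v else 0)"
      by (rule monoid_algebra_mult[OF fin(1) order_refl finV supp_monoid_algebra_mult])
    also have "\<dots> = (\<Sum>x\<in>?F. \<Sum>v\<in>?V. \<Sum>y\<in>?G. \<Sum>w\<in>?H.
        if v = y \<otimes>\<^bsub>M\<^esub> w then (if x \<otimes>\<^bsub>M\<^esub> v = z then f x * (g y * h w) else 0) else 0)"
      unfolding monoid_algebra_mult[OF fin(2) order_refl fin(3) order_refl]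
      by (intro sum.cong refl) (rule pull2)
    also have "\<dots> = (\<Sum>x\<in>?F. \<Sum>y\<in>?G. \<Sum>w\<in>?H. \<Sum>v\<in>?V.
        if v = y \<otimes>\<^bsub>M\<^esub> w then (if x \<otimes>\<^bsub>M\<^esub> v = z then f x * (g y * h w) else 0) else 0)"
      by (simp only: sum.swap[of _ _ ?V])
    also have "\<dots> = (\<Sum>x\<in>?F. \<Sum>y\<in>?G. \<Sum>w\<in>?H.
        if x \<otimes>\<^bsub>M\<^esub> (y \<otimes>\<^bsub>M\<^esub> w) = z then f x * (g y * h w) else 0)"
      by (intro sum.cong refl, subst sum.delta[OF finV]) force
    finally show "((f \<otimes>\<^bsub>?R\<^esub> g) \<otimes>\<^bsub>?R\<^esub> h) z = (f \<otimes>\<^bsub>?R\<^esub> (g \<otimes>\<^bsub>?R\<^esub> h)) z"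
      using 1 by simp
  qed
  have supp_one: "supp \<one>\<^bsub>?R\<^esub> \<subseteq> {\<one>\<^bsub>M\<^esub>}" by (auto simp: one supp_def)
  have sub: "supp f \<subseteq> carrier M" and fin: "finite (supp f)" if "f \<in> carrier ?R" for f
    using that by (auto simp: carr)
  have mon: "Group.monoid ?R"
  proof (rule monoidI)
    fix f assume f: "f \<in> carrier ?R"
    show "\<one>\<^bsub>?R\<^esub> \<otimes>\<^bsub>?R\<^esub> f = f"
    proof
      fix z
      have "(\<one>\<^bsub>?R\<^esub> \<otimes>\<^bsub>?R\<^esub> f) z = (\<Sum>y\<in>supp f. if \<one>\<^bsub>M\<^esub> \<otimes>\<^bsub>M\<^esub> y = z then f y else 0)"
        by (subst monoid_algebra_mult[OF _ supp_one fin[OF f] order_refl]) (simp_all add: one cong: if_cong)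
      also have "\<dots> = (\<Sum>y\<in>supp f. if y = z then f y else 0)"
        using sub[OF f] by (intro sum.cong) auto
      also have "\<dots> = f z" using fin[OF f] by (auto simp: supp_def)
      finally show "(\<one>\<^bsub>?R\<^esub> \<otimes>\<^bsub>?R\<^esub> f) z = f z" .
    qed
    show "f \<otimes>\<^bsub>?R\<^esub> \<one>\<^bsub>?R\<^esub> = f"
    proof
      fix z
      have "(f \<otimes>\<^bsub>?R\<^esub> \<one>\<^bsub>?R\<^esub>) z = (\<Sum>y\<in>supp f. if y \<otimes>\<^bsub>M\<^esub> \<one>\<^bsub>M\<^esub> = z then f y else 0)"
        by (subst monoid_algebra_mult[OF fin[OF f] order_refl _ supp_one]) (simp_all add: one cong: if_cong)
      also have "\<dots> = (\<Sum>y\<in>supp f. if y = z then f y else 0)"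
        using sub[OF f] by (intro sum.cong) auto
      also have "\<dots> = f z" using fin[OF f] by (auto simp: supp_def)
      finally show "(f \<otimes>\<^bsub>?R\<^esub> \<one>\<^bsub>?R\<^esub>) z = f z" .
    qed
  qed (use mult_cl one_cl assoc in auto)
  show ?thesis
  proof (rule ringI[OF ab mon])
    fix f g h assume f: "f \<in> carrier ?R" and g: "g \<in> carrier ?R" and h: "h \<in> carrier ?R"
    let ?X = "supp f \<union> supp g"
    have X: "finite ?X" "supp f \<subseteq> ?X" "supp g \<subseteq> ?X" using fin[OF f] fin[OF g] by auto
    have Xs: "supp (\<lambda>z. f z + g z) \<subseteq> ?X" by (rule supp_add)
    show "(f \<oplus>\<^bsub>?R\<^esub> g) \<otimes>\<^bsub>?R\<^esub> h = f \<otimes>\<^bsub>?R\<^esub> h \<oplus>\<^bsub>?R\<^esub> g \<otimes>\<^bsub>?R\<^esub> h"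
      unfolding add monoid_algebra_mult[OF X(1) Xs fin[OF h] order_refl]
        monoid_algebra_mult[OF X(1) X(2) fin[OF h] order_refl]
        monoid_algebra_mult[OF X(1) X(3) fin[OF h] order_refl] sum.distrib[symmetric]
      by (intro ext sum.cong refl) (simp add: algebra_simps)
    show "h \<otimes>\<^bsub>?R\<^esub> (f \<oplus>\<^bsub>?R\<^esub> g) = h \<otimes>\<^bsub>?R\<^esub> f \<oplus>\<^bsub>?R\<^esub> h \<otimes>\<^bsub>?R\<^esub> g"
      unfolding add monoid_algebra_mult[OF fin[OF h] order_refl X(1) Xs]
        monoid_algebra_mult[OF fin[OF h] order_refl X(1) X(2)]
        monoid_algebra_mult[OF fin[OF h] order_refl X(1) X(3)] sum.distrib[symmetric]
      by (intro ext sum.cong refl) (simp add: algebra_simps)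
  qed
qed

lemma quot_alg_simps:
  "carrier (quot_alg A I) = carrier (A Quot I)"
  "monoid.mult (quot_alg A I) = monoid.mult (A Quot I)"
  "monoid.one (quot_alg A I) = monoid.one (A Quot I)"
  "ring.zero (quot_alg A I) = ring.zero (A Quot I)"
  "ring.add (quot_alg A I) = ring.add (A Quot I)"
  by (simp_all add: quot_alg_def ring.defs module.defs)

lemma ring_quot_alg:
  assumes "ideal I A"
  shows "ring (quot_alg A I)"
proof -
  have "ring.truncate (quot_alg A I) = A Quot I"
    by (simp add: quot_alg_def ring.defs module.defs)
  moreover interpret Q: ring "A Quot I" by (rule ideal.quotient_is_ring[OF assms])
  show ?thesis
    by (rule ringI; (rule abelian_groupI monoidI)?)
       (use Q.l_distr Q.r_distr Q.m_assoc Q.a_assoc Q.a_comm Q.l_neg Q.a_inv_closed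
         in \<open>auto simp: quot_alg_simps intro!: bexI[of _ "\<ominus>\<^bsub>A Quot I\<^esub> _"]\<close>)
qed

text \<open>The scalar multiplication of a quotient is the induced one.\<close>

lemma quot_alg_smult:
  assumes "ideal I A" and x: "x \<in> carrier A"
    and smult: "\<And>c y. y \<in> carrier A \<Longrightarrow> c \<odot>\<^bsub>A\<^esub> y = (c \<odot>\<^bsub>A\<^esub> \<one>\<^bsub>A\<^esub>) \<otimes>\<^bsub>A\<^esub> y"
    and closed: "\<And>c. c \<odot>\<^bsub>A\<^esub> \<one>\<^bsub>A\<^esub> \<in> carrier A"
  shows "c \<odot>\<^bsub>quot_alg A I\<^esub> (I +>\<^bsub>A\<^esub> x) = I +>\<^bsub>A\<^esub> (c \<odot>\<^bsub>A\<^esub> x)"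
proof -
  interpret ideal I A by fact
  have eq: "I +>\<^bsub>A\<^esub> (c \<odot>\<^bsub>A\<^esub> y) = I +>\<^bsub>A\<^esub> (c \<odot>\<^bsub>A\<^esub> x)" if y: "y \<in> I +>\<^bsub>A\<^esub> x" for y
  proof -
    have yc: "y \<in> carrier A" using y x a_r_coset_subset_G a_subset by blast
    have "I +>\<^bsub>A\<^esub> y = I +>\<^bsub>A\<^esub> x" using a_repr_independence[OF y x] a_subgroup by metis
    then have "rcoset_mult A I (I +>\<^bsub>A\<^esub> (c \<odot>\<^bsub>A\<^esub> \<one>\<^bsub>A\<^esub>)) (I +>\<^bsub>A\<^esub> y) =
        rcoset_mult A I (I +>\<^bsub>A\<^esub> (c \<odot>\<^bsub>A\<^esub> \<one>\<^bsub>A\<^esub>)) (I +>\<^bsub>A\<^esub> x)" by simp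
    then show ?thesis
      unfolding rcoset_mult_add[OF closed yc] rcoset_mult_add[OF closed x]
        smult[OF yc, symmetric] smult[OF x, symmetric] .
  qed
  have "(\<Union>y\<in>I +>\<^bsub>A\<^esub> x. I +>\<^bsub>A\<^esub> (c \<odot>\<^bsub>A\<^esub> y)) = (\<Union>y\<in>I +>\<^bsub>A\<^esub> x. I +>\<^bsub>A\<^esub> (c \<odot>\<^bsub>A\<^esub> x))"
    by (rule SUP_cong[OF refl eq])
  also have "\<dots> = I +>\<^bsub>A\<^esub> (c \<odot>\<^bsub>A\<^esub> x)" using a_rcos_self[OF x] by blast
  finally show ?thesis by (simp add: quot_alg_def ring.defs module.defs)
qed

lemma monoid_algebra_smult:
  assumes "monoid M" and f: "f \<in> carrier (monoid_algebra M)"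
  shows "c \<odot>\<^bsub>monoid_algebra M\<^esub> f \<in> carrier (monoid_algebra M)"
    and "c \<odot>\<^bsub>monoid_algebra M\<^esub> f =
      (c \<odot>\<^bsub>monoid_algebra M\<^esub> \<one>\<^bsub>monoid_algebra M\<^esub>) \<otimes>\<^bsub>monoid_algebra M\<^esub> f"
proof -
  interpret M: monoid M by fact
  let ?R = "monoid_algebra M"
  have smult: "c \<odot>\<^bsub>?R\<^esub> g = (\<lambda>z. c * g z)" for g by (simp add: monoid_algebra_def)
  have one: "\<one>\<^bsub>?R\<^esub> = (\<lambda>z. if z = \<one>\<^bsub>M\<^esub> then 1 else 0)" by (simp add: monoid_algebra_def)
  have sub: "supp f \<subseteq> carrier M" and fin: "finite (supp f)"
    using f by (auto simp: monoid_algebra_def)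
  have "supp (\<lambda>z. c * f z) \<subseteq> supp f" by (auto simp: supp_def)
  then show "c \<odot>\<^bsub>?R\<^esub> f \<in> carrier ?R"
    using sub fin unfolding smult by (auto simp: monoid_algebra_def intro: finite_subset)
  have s: "supp (\<lambda>z. c * \<one>\<^bsub>?R\<^esub> z) \<subseteq> {\<one>\<^bsub>M\<^esub>}" by (auto simp: supp_def one)
  show "c \<odot>\<^bsub>?R\<^esub> f = (c \<odot>\<^bsub>?R\<^esub> \<one>\<^bsub>?R\<^esub>) \<otimes>\<^bsub>?R\<^esub> f"
  proof
    fix z
    have "((c \<odot>\<^bsub>?R\<^esub> \<one>\<^bsub>?R\<^esub>) \<otimes>\<^bsub>?R\<^esub> f) z =
        (\<Sum>y\<in>supp f. if \<one>\<^bsub>M\<^esub> \<otimes>\<^bsub>M\<^esub> y = z then c * f y else 0)"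
      unfolding smult
      by (subst monoid_algebra_mult[OF _ s fin order_refl]) (simp_all add: one cong: if_cong)
    also have "\<dots> = (\<Sum>y\<in>supp f. if y = z then c * f y else 0)"
      using sub by (intro sum.cong) auto
    also have "\<dots> = c * f z" using fin by (auto simp: supp_def)
    finally show "(c \<odot>\<^bsub>?R\<^esub> f) z = ((c \<odot>\<^bsub>?R\<^esub> \<one>\<^bsub>?R\<^esub>) \<otimes>\<^bsub>?R\<^esub> f) z" by (simp add: smult)
  qed
qed

lemma quot_monoid_algebra_smult:
  assumes M: "monoid M" and I: "ideal I (monoid_algebra M)" and f: "f \<in> carrier (monoid_algebra M)"
  shows "c \<odot>\<^bsub>quot_alg (monoid_algebra M) I\<^esub> (I +>\<^bsub>monoid_algebra M\<^esub> f) =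
    I +>\<^bsub>monoid_algebra M\<^esub> (c \<odot>\<^bsub>monoid_algebra M\<^esub> f)"
proof -
  interpret R: ring "monoid_algebra M" by (rule ring_monoid_algebra[OF M])
  show ?thesis
    by (rule quot_alg_smult[OF I f monoid_algebra_smult(2)[OF M] monoid_algebra_smult(1)[OF M R.one_closed]])
qed

lemma monoid_free_monoid: "Group.monoid (free_monoid X)"
  by (rule monoidI) (auto simp: free_monoid_def)

lemma clifford_ideal: "ideal (clifford_ideal r) (free_alg r)"
  and clifford_rels_subset: "clifford_rels r \<subseteq> clifford_ideal r"
proof -
  interpret F: ring "free_alg r" by (rule ring_monoid_algebra[OF monoid_free_monoid])
  have "basis_elt [i] \<in> carrier (free_alg r)" if "i < r" for i
    using that by (auto simp: monoid_algebra_def free_monoid_def basis_elt_def supp_def)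
  then have "clifford_rels r \<subseteq> carrier (free_alg r)"
    by (auto simp: clifford_rels_def Let_def)
  then show "ideal (clifford_ideal r) (free_alg r)" "clifford_rels r \<subseteq> clifford_ideal r"
    unfolding clifford_ideal_def by (rule F.genideal_ideal, rule F.genideal_self)
qed

lemma ring_clifford: "ring (clifford r)"
  unfolding clifford_def by (rule ring_quot_alg[OF clifford_ideal])

lemma clifford_gen_closed:
  assumes "i < r"
  shows "clifford_gen r i \<in> carrier (clifford r)"
proof -
  interpret I: ideal "clifford_ideal r" "free_alg r" by (rule clifford_ideal)
  have "basis_elt [i] \<in> carrier (free_alg r)"
    using assms by (auto simp: monoid_algebra_def free_monoid_def basis_elt_def supp_def)
  then show ?thesis
    by (auto simp: clifford_def clifford_gen_def quot_alg_simps FactRing_def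
        intro: I.a_rcosetsI[OF I.a_subset])
qed

lemma clifford_gen_square:
  assumes "i < r"
  shows "clifford_gen r i \<otimes>\<^bsub>clifford r\<^esub> clifford_gen r i = \<one>\<^bsub>clifford r\<^esub>"
proof -
  let ?F = "free_alg r" and ?x = "basis_elt [i]"
  interpret I: ideal "clifford_ideal r" ?F by (rule clifford_ideal)
  have x: "?x \<in> carrier ?F"
    using assms by (auto simp: monoid_algebra_def free_monoid_def basis_elt_def supp_def)
  have "?x \<otimes>\<^bsub>?F\<^esub> ?x \<ominus>\<^bsub>?F\<^esub> \<one>\<^bsub>?F\<^esub> \<in> clifford_rels r"
    unfolding clifford_rels_def Let_def using assms by blast
  then have "?x \<otimes>\<^bsub>?F\<^esub> ?x \<ominus>\<^bsub>?F\<^esub> \<one>\<^bsub>?F\<^esub> \<in> clifford_ideal r"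
    using clifford_rels_subset by blast
  then have "clifford_ideal r +>\<^bsub>?F\<^esub> (?x \<otimes>\<^bsub>?F\<^esub> ?x) = clifford_ideal r +>\<^bsub>?F\<^esub> \<one>\<^bsub>?F\<^esub>"
    using x I.quotient_eq_iff_same_a_r_cos[OF I.is_ideal] by blast
  then show ?thesis
    by (simp add: clifford_def clifford_gen_def quot_alg_simps FactRing_def I.rcoset_mult_add[OF x x])
qed

lemma clifford_gen_anticommute:
  assumes "i < r" "j < r" "i \<noteq> j"
  shows "clifford_gen r i \<otimes>\<^bsub>clifford r\<^esub> clifford_gen r j \<oplus>\<^bsub>clifford r\<^esub>
    clifford_gen r j \<otimes>\<^bsub>clifford r\<^esub> clifford_gen r i = \<zero>\<^bsub>clifford r\<^esub>"
proof -
  let ?F = "free_alg r" and ?x = "basis_elt [i]" and ?y = "basis_elt [j]"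
  interpret I: ideal "clifford_ideal r" ?F by (rule clifford_ideal)
  have x: "?x \<in> carrier ?F" and y: "?y \<in> carrier ?F"
    using assms by (auto simp: monoid_algebra_def free_monoid_def basis_elt_def supp_def)
  have "?x \<otimes>\<^bsub>?F\<^esub> ?y \<oplus>\<^bsub>?F\<^esub> ?y \<otimes>\<^bsub>?F\<^esub> ?x \<in> clifford_rels r"
    unfolding clifford_rels_def Let_def using assms by blast
  then have "?x \<otimes>\<^bsub>?F\<^esub> ?y \<oplus>\<^bsub>?F\<^esub> ?y \<otimes>\<^bsub>?F\<^esub> ?x \<in> clifford_ideal r"
    using clifford_rels_subset by blast
  then show ?thesis
    using x y
    by (simp add: clifford_def clifford_gen_def quot_alg_simps FactRing_def
        I.rcoset_mult_add I.a_rcos_sum I.a_rcos_const)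
qed

lemma tensor_ideal:
  assumes A: "ring A" and B: "ring B"
    and smA: "\<And>c x. x \<in> carrier A \<Longrightarrow> c \<odot>\<^bsub>A\<^esub> x \<in> carrier A"
    and smB: "\<And>c x. x \<in> carrier B \<Longrightarrow> c \<odot>\<^bsub>B\<^esub> x \<in> carrier B"
  shows "ideal (tensor_ideal A B) (monoid_algebra (A \<times>\<times> B))"
    and "tensor_rels A B \<subseteq> tensor_ideal A B"
proof -
  interpret A: ring A by fact
  interpret B: ring B by fact
  let ?F = "monoid_algebra (A \<times>\<times> B)"
  interpret F: ring ?F
    by (intro ring_monoid_algebra DirProd_monoid A.monoid_axioms B.monoid_axioms)
  have b: "basis_elt (x, y) \<in> carrier ?F" if "x \<in> carrier A" "y \<in> carrier B" for x y
    using that by (auto simp: monoid_algebra_def basis_elt_def supp_def)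
  have s: "c \<odot>\<^bsub>?F\<^esub> f \<in> carrier ?F" if "f \<in> carrier ?F" for c f
  proof -
    have "supp (\<lambda>z. c * f z) \<subseteq> supp f" by (auto simp: supp_def)
    with that show ?thesis by (auto simp: monoid_algebra_def intro: finite_subset)
  qed
  have "tensor_rels A B \<subseteq> carrier ?F"
    by (auto simp: tensor_rels_def Let_def smA smB b s)
  then show "ideal (tensor_ideal A B) ?F" "tensor_rels A B \<subseteq> tensor_ideal A B"
    unfolding tensor_ideal_def by (rule F.genideal_ideal, rule F.genideal_self)
qed

lemma ring_CC: "ring (CC p q)"
proof -
  have sm: "c \<odot>\<^bsub>clifford r\<^esub> x \<in> carrier (clifford r)" if "x \<in> carrier (clifford r)" for c x r
  proof -
    interpret I: ideal "clifford_ideal r" "free_alg r" by (rule clifford_ideal)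
    from that obtain f where f: "f \<in> carrier (free_alg r)"
        and x: "x = clifford_ideal r +>\<^bsub>free_alg r\<^esub> f"
      by (auto simp: clifford_def quot_alg_simps FactRing_def A_RCOSETS_def')
    show ?thesis
      unfolding x clifford_def quot_monoid_algebra_smult[OF monoid_free_monoid clifford_ideal f]
      using monoid_algebra_smult(1)[OF monoid_free_monoid f]
      by (auto simp: quot_alg_simps FactRing_def A_RCOSETS_def')
  qed
  show ?thesis
    unfolding CC_def tensor_alg_def
    by (rule ring_quot_alg, rule tensor_ideal(1)[OF ring_clifford ring_clifford sm sm])
qed

text \<open>\<open>\<phi>\<close> is half the gradient of \<open>log |P|\<close>, and maps \<open>\<Omega>\<close> to itself.\<close>

lemma Pform_shift:
  assumes v: "v \<in> carrier_vec (p + q)" and i: "i < p + q"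
  shows "Pform p q (v + t \<cdot>\<^sub>v unit_vec (p + q) i) =
    Pform p q v + (if i < p then 1 else -1) * (2 * t * v $ i + t^2)"
proof -
  have c: "(v + t \<cdot>\<^sub>v unit_vec (p + q) i) $ k = v $ k + (if k = i then t else 0)"
    if "k < p + q" for k using that v i by (auto simp: unit_vec_def)
  have sq: "((v + t \<cdot>\<^sub>v unit_vec (p + q) i) $ k)^2 =
      (v $ k)^2 + (if k = i then 2 * t * v $ i + t^2 else 0)" if "k < p + q" for k
    using c[OF that] by (auto simp: power2_sum)
  have 1: "(\<Sum>k<p. ((v + t \<cdot>\<^sub>v unit_vec (p + q) i) $ k)^2) =
      (\<Sum>k<p. (v $ k)^2) + (if i < p then 2 * t * v $ i + t^2 else 0)"
    by (subst sum.cong[OF refl sq]) (auto simp: sum.distrib sum.delta)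
  have "(\<Sum>k<q. ((v + t \<cdot>\<^sub>v unit_vec (p + q) i) $ (p + k))^2) =
      (\<Sum>k<q. (v $ (p + k))^2 + (if k = i - p \<and> p \<le> i then 2 * t * v $ i + t^2 else 0))"
    by (rule sum.cong[OF refl], subst sq) auto
  also have "\<dots> = (\<Sum>k<q. (v $ (p + k))^2) + (if p \<le> i then 2 * t * v $ i + t^2 else 0)"
  proof (cases "p \<le> i")
    case True
    then have "i - p < q" using i by auto
    with True show ?thesis by (simp add: sum.distrib sum.delta)
  qed simp
  finally have 2: "(\<Sum>k<q. ((v + t \<cdot>\<^sub>v unit_vec (p + q) i) $ (p + k))^2) =
      (\<Sum>k<q. (v $ (p + k))^2) + (if p \<le> i then 2 * t * v $ i + t^2 else 0)" .
  show ?thesis unfolding Pform_def 1 2 by auto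
qed

lemma phi_eq_half_grad_log:
  assumes v: "v \<in> Omega p q" and i: "i < p + q"
  shows "((\<lambda>t. 1/2 * ln \<bar>Pform p q (v + t \<cdot>\<^sub>v unit_vec (p + q) i)\<bar>)
    has_real_derivative phi p q v $ i) (at 0)"
proof -
  define s where "s = (if i < p then 1 else -1 :: real)"
  have vc: "v \<in> carrier_vec (p + q)" and nz: "Pform p q v \<noteq> 0" using v by (auto simp: Omega_def)
  have eq: "1/2 * ln \<bar>Pform p q (v + t \<cdot>\<^sub>v unit_vec (p + q) i)\<bar> =
      1/4 * ln ((Pform p q v + s * (2 * t * v $ i + t^2))^2)" for t
  proof (cases "Pform p q v + s * (2 * t * v $ i + t^2) = 0")
    case False
    have "ln ((Pform p q v + s * (2 * t * v $ i + t^2))^2) =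
        ln (\<bar>Pform p q v + s * (2 * t * v $ i + t^2)\<bar>^2)" by simp
    also have "\<dots> = 2 * ln \<bar>Pform p q v + s * (2 * t * v $ i + t^2)\<bar>"
      using False by (subst ln_realpow) auto
    finally show ?thesis unfolding Pform_shift[OF vc i] s_def by simp
  qed (simp add: Pform_shift[OF vc i] s_def)
  have "((\<lambda>t. 1/4 * ln ((Pform p q v + s * (2 * t * v $ i + t^2))^2))
      has_real_derivative s * v $ i / Pform p q v) (at 0)"
    using nz by (auto intro!: derivative_eq_intros simp: field_simps power2_eq_square zero_less_mult_iff linorder_neq_iff)
  moreover have "phi p q v $ i = s * v $ i / Pform p q v"
    using i by (simp add: phi_def s_def)
  ultimately show ?thesis unfolding eq by simp
qed

lemma phi_in_Omega:
  assumes v: "v \<in> Omega p q"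
  shows "phi p q v \<in> Omega p q"
proof -
  have nz: "Pform p q v \<noteq> 0" using v by (auto simp: Omega_def)
  have "Pform p q (phi p q v) = Pform p q v / (Pform p q v)^2"
    by (subst Pform_def) (simp add: phi_def power_divide Pform_def[of p q v] diff_divide_distrib
        sum_divide_distrib)
  then show ?thesis using nz by (auto simp: Omega_def phi_def)
qed

lemma quad_map_inject:
  assumes S: "\<forall>i<n. S i \<in> Sym m" and T: "\<forall>i<n. T i \<in> Sym m"
    and eq: "quad_map n m S = quad_map n m T" and i: "i < n"
  shows "S i = T i"
proof -
  have q: "w \<bullet> (S i *\<^sub>v w) = w \<bullet> (T i *\<^sub>v w)" if "w \<in> carrier_vec m" for w
    using fun_cong[OF eq, of w] that i
    by (auto simp: quad_map_def dest!: arg_cong[where f = "\<lambda>u. u $ i"])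
  have bil: "(unit_vec m j + unit_vec m k) \<bullet> (A *\<^sub>v (unit_vec m j + unit_vec m k)) =
      A $$ (j, j) + A $$ (k, k) + 2 * A $$ (j, k)"
    if A: "A \<in> Sym m" and j: "j < m" and k: "k < m" for A :: "real mat" and j k
  proof -
    have c: "A \<in> carrier_mat m m" and "transpose_mat A = A" using A by (auto simp: Sym_def)
    then have s: "A $$ (k, j) = A $$ (j, k)" using j k by (metis carrier_matD index_transpose_mat(1))
    have e: "unit_vec m a \<bullet> (A *\<^sub>v unit_vec m b) = A $$ (a, b)" if "a < m" "b < m" for a b
      using that c by (auto simp: scalar_prod_left_unit scalar_prod_right_unit)
    have "A *\<^sub>v (unit_vec m j + unit_vec m k) = A *\<^sub>v unit_vec m j + A *\<^sub>v unit_vec m k"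
      using c by (simp add: mult_add_distrib_mat_vec)
    then have "(unit_vec m j + unit_vec m k) \<bullet> (A *\<^sub>v (unit_vec m j + unit_vec m k)) =
        unit_vec m j \<bullet> (A *\<^sub>v unit_vec m j) + unit_vec m j \<bullet> (A *\<^sub>v unit_vec m k) +
        (unit_vec m k \<bullet> (A *\<^sub>v unit_vec m j) + unit_vec m k \<bullet> (A *\<^sub>v unit_vec m k))"
      using c by (simp add: add_scalar_prod_distrib[where n = m] scalar_prod_add_distrib[where n = m])
    then show ?thesis using e j k s by simp
  qed
  have diag: "S i $$ (j, j) = T i $$ (j, j)" if j: "j < m" for j
    using q[of "unit_vec m j + unit_vec m j"] bil[OF _ j j, of "S i"] bil[OF _ j j, of "T i"] S T i
    by simp
  show ?thesis
  proof (rule eq_matI)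
    fix j k assume "j < dim_row (T i)" "k < dim_col (T i)"
    then have j: "j < m" and k: "k < m" using T i by (auto simp: Sym_def)
    show "S i $$ (j, k) = T i $$ (j, k)"
      using q[of "unit_vec m j + unit_vec m k"] bil[OF _ j k, of "S i"] bil[OF _ j k, of "T i"]
        diag[OF j] diag[OF k] S T i by simp
  next
    have "S i \<in> carrier_mat m m" "T i \<in> carrier_mat m m" using S T i by (auto simp: Sym_def)
    then show "dim_row (S i) = dim_row (T i)" "dim_col (S i) = dim_col (T i)" by auto
  qed
qed

end

theory Submission
  imports Defs
begin

text \<open>
  Write \<open>\<epsilon>\<^sub>i\<close> for the signature of \<open>P\<close>. Then \<open>P(v) S(v) S(\<phi>(v))\<close> is the double sum of
  \<open>v\<^sub>i v\<^sub>j \<epsilon>\<^sub>j S\<^sub>i S\<^sub>j\<close>, so self-duality means that the symmetrized coefficients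
  \<open>\<epsilon>\<^sub>j S\<^sub>i S\<^sub>j + \<epsilon>\<^sub>i S\<^sub>j S\<^sub>i\<close> equal \<open>2 \<epsilon>\<^sub>i \<delta>\<^sub>i\<^sub>j\<close>; testing on \<open>e\<^sub>i\<close> and \<open>2 e\<^sub>i + e\<^sub>j\<close> suffices to
  see this. These are the relations \<open>S\<^sub>i\<^sup>2 = 1\<close>, anticommutation within a block of indices and
  commutation across the two blocks, that is, the defining relations of \<open>C\<^sub>p \<otimes> C\<^sub>q\<close>. By its universal
  property such a family is the image of the generators under a unique representation.
\<close>

subsection \<open>Real algebras\<close>

text \<open>The scalars are the type \<open>real\<close> itself, so scalar multiplication is a plain
  function with no carrier of scalars. The last two axioms make scalars central. Monoid algebras,
  quotients, tensor products and matrix algebras are all shown below to be instances.\<close>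

locale assoc_real_algebra = ring A for A :: "(real, 'a) module" (structure) +
  assumes smult_closed [simp, intro]: "x \<in> carrier A \<Longrightarrow> c \<odot> x \<in> carrier A"
    and smult_l_distr: "x \<in> carrier A \<Longrightarrow> (c + d) \<odot> x = c \<odot> x \<oplus> d \<odot> x"
    and smult_r_distr: "x \<in> carrier A \<Longrightarrow> y \<in> carrier A \<Longrightarrow> c \<odot> (x \<oplus> y) = c \<odot> x \<oplus> c \<odot> y"
    and smult_assoc: "x \<in> carrier A \<Longrightarrow> (c * d) \<odot> x = c \<odot> (d \<odot> x)"
    and smult_one [simp]: "x \<in> carrier A \<Longrightarrow> 1 \<odot> x = x"
    and smult_mult_left: "x \<in> carrier A \<Longrightarrow> y \<in> carrier A \<Longrightarrow> (c \<odot> x) \<otimes> y = c \<odot> (x \<otimes> y)"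
    and smult_mult_right: "x \<in> carrier A \<Longrightarrow> y \<in> carrier A \<Longrightarrow> x \<otimes> (c \<odot> y) = c \<odot> (x \<otimes> y)"
begin

lemma smult_zero [simp]: "c \<odot> \<zero> = \<zero>"
proof -
  have "c \<odot> \<zero> \<oplus> c \<odot> \<zero> = c \<odot> \<zero>" using smult_r_distr[of \<zero> \<zero> c] by simp
  then show ?thesis by (metis add.l_cancel_one smult_closed zero_closed)
qed

lemma zero_smult [simp]: assumes "x \<in> carrier A" shows "0 \<odot> x = \<zero>"
proof -
  have "0 \<odot> x \<oplus> 0 \<odot> x = 0 \<odot> x" using smult_l_distr[OF assms, of 0 0] by simp
  then show ?thesis by (metis add.l_cancel_one smult_closed assms)
qed

end

lemma alg_homI:
  assumes "h \<in> Ring.ring_hom A B" "h \<in> extensional (carrier A)"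
    and "\<And>c x. x \<in> carrier A \<Longrightarrow> h (c \<odot>\<^bsub>A\<^esub> x) = c \<odot>\<^bsub>B\<^esub> h x"
  shows "h \<in> alg_hom A B"
  using assms by (simp add: alg_hom_def)

lemma alg_homD:
  assumes "h \<in> alg_hom A B"
  shows "h \<in> Ring.ring_hom A B" "h \<in> extensional (carrier A)"
    and "x \<in> carrier A \<Longrightarrow> h (c \<odot>\<^bsub>A\<^esub> x) = c \<odot>\<^bsub>B\<^esub> h x"
    and "x \<in> carrier A \<Longrightarrow> h x \<in> carrier B"
    and "x \<in> carrier A \<Longrightarrow> y \<in> carrier A \<Longrightarrow> h (x \<otimes>\<^bsub>A\<^esub> y) = h x \<otimes>\<^bsub>B\<^esub> h y"
    and "x \<in> carrier A \<Longrightarrow> y \<in> carrier A \<Longrightarrow> h (x \<oplus>\<^bsub>A\<^esub> y) = h x \<oplus>\<^bsub>B\<^esub> h y"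
    and "h \<one>\<^bsub>A\<^esub> = \<one>\<^bsub>B\<^esub>"
  using assms by (auto simp: alg_hom_def Ring.ring_hom_def)

lemma alg_hom_ring_hom_ring:
  assumes "assoc_real_algebra A" "assoc_real_algebra B" "h \<in> alg_hom A B"
  shows "ring_hom_ring A B h"
  using assms by (intro ring_hom_ringI2 assoc_real_algebra.axioms(1) alg_homD(1))

subsection \<open>Quotient algebras\<close>

lemma quot_alg_proj_smult:
  assumes "assoc_real_algebra A" "ideal I A" "x \<in> carrier A"
  shows "c \<odot>\<^bsub>quot_alg A I\<^esub> (I +>\<^bsub>A\<^esub> x) = I +>\<^bsub>A\<^esub> (c \<odot>\<^bsub>A\<^esub> x)"
proof -
  interpret assoc_real_algebra A by fact
  show ?thesis by (rule quot_alg_smult[OF assms(2,3)]) (simp_all add: smult_mult_left)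
qed

lemma quot_alg_proj:
  assumes "ideal I A"
  shows "(+>\<^bsub>A\<^esub>) I \<in> Ring.ring_hom A (quot_alg A I)"
  using ideal.rcos_ring_hom[OF assms] by (simp add: Ring.ring_hom_def quot_alg_simps)

lemma quot_alg_carrier:
  assumes "ideal I A"
  shows "carrier (quot_alg A I) = (\<lambda>x. I +>\<^bsub>A\<^esub> x) ` carrier A"
  by (auto simp: quot_alg_simps FactRing_def A_RCOSETS_def')

lemma assoc_real_algebra_quot_alg:
  assumes A: "assoc_real_algebra A" and I: "ideal I A"
  shows "assoc_real_algebra (quot_alg A I)"
proof -
  interpret assoc_real_algebra A by fact
  \<comment> \<open>Oriented towards a single coset, these laws compute with representatives, so
    each axiom of the quotient is inherited from \<open>A\<close>.\<close>
  note pr = ring_hom_add[OF quot_alg_proj[OF I], symmetric] ring_hom_mult[OF quot_alg_proj[OF I], symmetric]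
    quot_alg_proj_smult[OF A I]
  show ?thesis
    by (intro assoc_real_algebra.intro assoc_real_algebra_axioms.intro ring_quot_alg[OF I])
      (auto simp: quot_alg_carrier[OF I] pr smult_l_distr smult_r_distr smult_assoc
        smult_mult_left smult_mult_right)
qed

text \<open>The kernel of \<open>h\<close> is an ideal containing the relations \<open>S\<close>,
  hence contains the ideal they generate; so \<open>h\<close> is constant on cosets and descends.
  This is how the algebras given by relations acquire their homomorphisms below.\<close>

lemma quot_alg_lift:
  assumes A: "assoc_real_algebra A" and B: "assoc_real_algebra B" and S: "S \<subseteq> carrier A"
    and h: "h \<in> alg_hom A B" and ker: "\<And>x. x \<in> S \<Longrightarrow> h x = \<zero>\<^bsub>B\<^esub>"
  obtains k where "k \<in> alg_hom (quot_alg A (Idl\<^bsub>A\<^esub> S)) B"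
    and "\<And>x. x \<in> carrier A \<Longrightarrow> k (Idl\<^bsub>A\<^esub> S +>\<^bsub>A\<^esub> x) = h x"
proof -
  interpret A: assoc_real_algebra A by fact
  interpret B: assoc_real_algebra B by fact
  interpret h: ring_hom_ring A B h by (rule alg_hom_ring_hom_ring[OF A B h])
  define I where "I = Idl\<^bsub>A\<^esub> S"
  have I: "ideal I A" unfolding I_def by (rule A.genideal_ideal[OF S])
  have "I \<subseteq> a_kernel A B h"
    unfolding I_def
  proof (rule A.genideal_minimal[OF h.kernel_is_ideal])
    show "S \<subseteq> a_kernel A B h" using S ker unfolding a_kernel_def' by blast
  qed
  then have ker_I: "h x = \<zero>\<^bsub>B\<^esub>" if "x \<in> I" for x
    using that unfolding a_kernel_def' by blast
  have eq: "h x = h y" if "x \<in> carrier A" "y \<in> carrier A" "I +>\<^bsub>A\<^esub> x = I +>\<^bsub>A\<^esub> y" for x y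
  proof -
    have "x \<ominus>\<^bsub>A\<^esub> y \<in> I" using that A.quotient_eq_iff_same_a_r_cos[OF I] by blast
    moreover have "x = (x \<ominus>\<^bsub>A\<^esub> y) \<oplus>\<^bsub>A\<^esub> y"
      using that by (simp add: a_minus_def A.a_assoc A.l_neg)
    ultimately have "h x = \<zero>\<^bsub>B\<^esub> \<oplus>\<^bsub>B\<^esub> h y"
      using that ker_I by (metis A.minus_closed h.hom_add)
    then show ?thesis using that by simp
  qed
  \<comment> \<open>A coset is evaluated at a chosen representative; \<open>eq\<close> makes the
    choice immaterial. Restriction to the carrier supplies the extensionality that
    \<open>alg_hom\<close> demands.\<close>
  define k where "k = (\<lambda>X\<in>carrier (quot_alg A I). h (SOME x. x \<in> carrier A \<and> I +>\<^bsub>A\<^esub> x = X))"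
  have k: "k (I +>\<^bsub>A\<^esub> x) = h x" if x: "x \<in> carrier A" for x
  proof -
    have "\<exists>y. y \<in> carrier A \<and> I +>\<^bsub>A\<^esub> y = I +>\<^bsub>A\<^esub> x" using x by blast
    from someI_ex[OF this] show ?thesis
      using x by (auto simp: k_def quot_alg_carrier[OF I] intro: eq)
  qed
  note pr = ring_hom_add[OF quot_alg_proj[OF I], symmetric] ring_hom_mult[OF quot_alg_proj[OF I], symmetric]
    ring_hom_one[OF quot_alg_proj[OF I], symmetric] quot_alg_proj_smult[OF A I]
  have "k \<in> alg_hom (quot_alg A I) B"
  proof (rule alg_homI)
    show "k \<in> Ring.ring_hom (quot_alg A I) B"
      by (rule ring_hom_memI) (auto simp: quot_alg_carrier[OF I] k pr)
    show "k \<in> extensional (carrier (quot_alg A I))" by (simp add: k_def)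
  qed (auto simp: quot_alg_carrier[OF I] k pr alg_homD(3)[OF h])
  then show ?thesis using that k unfolding I_def by blast
qed

subsection \<open>Monoid algebras\<close>

lemma monoid_algebra_simps:
  "f \<in> carrier (monoid_algebra M) \<longleftrightarrow> finite (supp f) \<and> supp f \<subseteq> carrier M"
  "\<one>\<^bsub>monoid_algebra M\<^esub> = basis_elt \<one>\<^bsub>M\<^esub>"
  "\<zero>\<^bsub>monoid_algebra M\<^esub> = (\<lambda>z. 0)"
  "f \<oplus>\<^bsub>monoid_algebra M\<^esub> g = (\<lambda>z. f z + g z)"
  "c \<odot>\<^bsub>monoid_algebra M\<^esub> f = (\<lambda>z. c * f z)"
  by (simp_all add: monoid_algebra_def basis_elt_def)

lemma basis_elt_closed: "x \<in> carrier M \<Longrightarrow> basis_elt x \<in> carrier (monoid_algebra M)"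
  by (auto simp: monoid_algebra_simps basis_elt_def supp_def)

lemma basis_elt_mult:
  "basis_elt x \<otimes>\<^bsub>monoid_algebra M\<^esub> basis_elt y = basis_elt (x \<otimes>\<^bsub>M\<^esub> y)"
proof
  fix z
  have s: "supp (basis_elt u) \<subseteq> {u}" for u :: 'a by (auto simp: supp_def basis_elt_def)
  show "(basis_elt x \<otimes>\<^bsub>monoid_algebra M\<^esub> basis_elt y) z = basis_elt (x \<otimes>\<^bsub>M\<^esub> y) z"
    by (subst monoid_algebra_mult[OF _ s _ s]) (auto simp: basis_elt_def)
qed

lemma assoc_real_algebra_monoid_algebra:
  assumes M: "monoid M"
  shows "assoc_real_algebra (monoid_algebra M)"
proof (intro assoc_real_algebra.intro assoc_real_algebra_axioms.intro ring_monoid_algebra[OF M])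
  fix f g c assume fg: "f \<in> carrier (monoid_algebra M)" "g \<in> carrier (monoid_algebra M)"
  \<comment> \<open>Scaling may shrink a support, to the empty set when \<open>c = 0\<close>, so
    both products are expanded over the support of the unscaled function.\<close>
  have s: "supp (\<lambda>z. c * f z) \<subseteq> supp f" for c and f :: "'a \<Rightarrow> real" by (auto simp: supp_def)
  have fin: "finite (supp f)" "finite (supp g)" using fg by (auto simp: monoid_algebra_simps)
  have "((c \<odot>\<^bsub>monoid_algebra M\<^esub> f) \<otimes>\<^bsub>monoid_algebra M\<^esub> g) z =
      (c \<odot>\<^bsub>monoid_algebra M\<^esub> (f \<otimes>\<^bsub>monoid_algebra M\<^esub> g)) z" for z
    unfolding monoid_algebra_simps monoid_algebra_mult[OF fin(1) s fin(2) order_refl]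
      monoid_algebra_mult[OF fin(1) order_refl fin(2) order_refl] sum_distrib_left
    by (intro sum.cong) auto
  then show "(c \<odot>\<^bsub>monoid_algebra M\<^esub> f) \<otimes>\<^bsub>monoid_algebra M\<^esub> g =
      c \<odot>\<^bsub>monoid_algebra M\<^esub> (f \<otimes>\<^bsub>monoid_algebra M\<^esub> g)" ..
  have "(f \<otimes>\<^bsub>monoid_algebra M\<^esub> (c \<odot>\<^bsub>monoid_algebra M\<^esub> g)) z =
      (c \<odot>\<^bsub>monoid_algebra M\<^esub> (f \<otimes>\<^bsub>monoid_algebra M\<^esub> g)) z" for z
    unfolding monoid_algebra_simps monoid_algebra_mult[OF fin(1) order_refl fin(2) s]
      monoid_algebra_mult[OF fin(1) order_refl fin(2) order_refl] sum_distrib_left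
    by (intro sum.cong) auto
  then show "f \<otimes>\<^bsub>monoid_algebra M\<^esub> (c \<odot>\<^bsub>monoid_algebra M\<^esub> g) =
      c \<odot>\<^bsub>monoid_algebra M\<^esub> (f \<otimes>\<^bsub>monoid_algebra M\<^esub> g)" ..
qed (use monoid_algebra_smult(1)[OF M] in \<open>auto simp: monoid_algebra_simps algebra_simps\<close>)

text \<open>A finitely supported function is a finite linear combination of basis elements; peeling
  off one term at a time reduces statements about linear maps to basis elements.\<close>

lemma monoid_algebra_induct [consumes 2, case_names zero add]:
  assumes M: "monoid M" and f: "f \<in> carrier (monoid_algebra M)"
    and zero: "P \<zero>\<^bsub>monoid_algebra M\<^esub>"
    and add: "\<And>c x f. x \<in> carrier M \<Longrightarrow> f \<in> carrier (monoid_algebra M) \<Longrightarrow> P f \<Longrightarrow>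
      P (c \<odot>\<^bsub>monoid_algebra M\<^esub> basis_elt x \<oplus>\<^bsub>monoid_algebra M\<^esub> f)"
  shows "P f"
proof -
  \<comment> \<open>The induction runs over a finite set containing the support. Setting
    \<open>f x\<close> to 0 moves the support into the smaller set, whether or not \<open>x\<close>
    belonged to it.\<close>
  have "P f" if "finite X" "X \<subseteq> carrier M" "supp f \<subseteq> X" for X f
    using that
  proof (induction X arbitrary: f)
    case empty
    then have "f = \<zero>\<^bsub>monoid_algebra M\<^esub>" by (auto simp: monoid_algebra_simps supp_def)
    then show ?case using zero by simp
  next
    case (insert x X)
    let ?g = "f(x := 0)"
    have g: "supp ?g \<subseteq> X" using insert.prems by (auto simp: supp_def)
    then have "?g \<in> carrier (monoid_algebra M)"
      using insert.hyps insert.prems by (auto simp: monoid_algebra_simps intro: finite_subset)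
    moreover have "P ?g" using g insert by simp
    moreover have "f = f x \<odot>\<^bsub>monoid_algebra M\<^esub> basis_elt x \<oplus>\<^bsub>monoid_algebra M\<^esub> ?g"
      by (auto simp: monoid_algebra_simps basis_elt_def)
    ultimately show ?case using add[of x ?g "f x"] insert.prems by simp
  qed
  then show ?thesis using f by (auto simp: monoid_algebra_simps)
qed

text \<open>Linear extension of \<open>s\<close>: on basis elements multiplicativity is that of
  \<open>s\<close>, and bilinearity spreads it to all products. The unit is a separate hypothesis
  because \<open>hom\<close> demands only closure and multiplicativity.\<close>

lemma monoid_algebra_lift:
  assumes M: "monoid M" and B: "assoc_real_algebra B"
    and s: "s \<in> hom M B" and s1: "s \<one>\<^bsub>M\<^esub> = \<one>\<^bsub>B\<^esub>"
  obtains h where "h \<in> alg_hom (monoid_algebra M) B"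
    and "\<And>x. x \<in> carrier M \<Longrightarrow> h (basis_elt x) = s x"
proof -
  interpret M: monoid M by fact
  interpret B: assoc_real_algebra B by fact
  let ?F = "monoid_algebra M"
  interpret F: assoc_real_algebra ?F by (rule assoc_real_algebra_monoid_algebra[OF M])
  define h where "h = (\<lambda>f\<in>carrier ?F. \<Oplus>\<^bsub>B\<^esub>x\<in>supp f. f x \<odot>\<^bsub>B\<^esub> s x)"
  have s_cl: "s x \<in> carrier B" if "x \<in> carrier M" for x using s that by (auto simp: hom_def)
  \<comment> \<open>Enlarging the index set adds only zero terms, so two elements can be summed over
    one common set when additivity is proved.\<close>
  have h: "h f = (\<Oplus>\<^bsub>B\<^esub>x\<in>X. f x \<odot>\<^bsub>B\<^esub> s x)"
    if "f \<in> carrier ?F" "finite X" "X \<subseteq> carrier M" "supp f \<subseteq> X" for f X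
    unfolding h_def using that s_cl
    by simp (intro B.add.finprod_mono_neutral_cong_left; force simp: supp_def)
  have h_cl: "h f \<in> carrier B" if "f \<in> carrier ?F" for f
    using that s_cl by (subst h[OF that, of "supp f"])
      (auto simp: monoid_algebra_simps intro!: B.finsum_closed)
  have h_add: "h (f \<oplus>\<^bsub>?F\<^esub> g) = h f \<oplus>\<^bsub>B\<^esub> h g"
    if f: "f \<in> carrier ?F" and g: "g \<in> carrier ?F" for f g
  proof -
    let ?X = "supp f \<union> supp g"
    have X: "finite ?X" "?X \<subseteq> carrier M" using f g by (auto simp: monoid_algebra_simps)
    then have cl: "s x \<in> carrier B" if "x \<in> ?X" for x using that s_cl by blast
    have "h (f \<oplus>\<^bsub>?F\<^esub> g) = (\<Oplus>\<^bsub>B\<^esub>x\<in>?X. (f \<oplus>\<^bsub>?F\<^esub> g) x \<odot>\<^bsub>B\<^esub> s x)"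
      using f g by (intro h X F.add.m_closed) (auto simp: supp_def monoid_algebra_simps)
    also have "\<dots> = (\<Oplus>\<^bsub>B\<^esub>x\<in>?X. f x \<odot>\<^bsub>B\<^esub> s x \<oplus>\<^bsub>B\<^esub> g x \<odot>\<^bsub>B\<^esub> s x)"
      using cl by (intro B.finsum_cong') (auto simp: monoid_algebra_simps B.smult_l_distr)
    also have "\<dots> = h f \<oplus>\<^bsub>B\<^esub> h g"
      using cl unfolding h[OF f X Un_upper1] h[OF g X Un_upper2]
      by (intro B.finsum_addf) auto
    finally show ?thesis .
  qed
  have h_zero: "h \<zero>\<^bsub>?F\<^esub> = \<zero>\<^bsub>B\<^esub>" by (subst h[of _ "{}"]) (auto simp: monoid_algebra_simps supp_def)
  have h_basis: "h (c \<odot>\<^bsub>?F\<^esub> basis_elt x) = c \<odot>\<^bsub>B\<^esub> s x" if x: "x \<in> carrier M" for c x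
    using x s_cl by (subst h[of _ "{x}"])
      (auto simp: basis_elt_closed, auto simp: monoid_algebra_simps basis_elt_def supp_def split: if_splits)
  have h_basis1: "h (basis_elt x) = s x" if x: "x \<in> carrier M" for x
    using h_basis[OF x, of 1] x s_cl by (simp add: basis_elt_closed)
  have h_smult: "h (c \<odot>\<^bsub>?F\<^esub> f) = c \<odot>\<^bsub>B\<^esub> h f" if "f \<in> carrier ?F" for c f
    using M that
    by (induction f rule: monoid_algebra_induct)
      (simp_all add: h_zero F.smult_r_distr h_add basis_elt_closed h_basis B.smult_r_distr s_cl h_cl
        flip: F.smult_assoc B.smult_assoc)
  \<comment> \<open>Multiplicativity takes two inductions: first over the right factor with a basis
    element on the left, then over the left factor.\<close>
  have h_mult_basis: "h (basis_elt x \<otimes>\<^bsub>?F\<^esub> g) = s x \<otimes>\<^bsub>B\<^esub> h g"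
    if x: "x \<in> carrier M" and g: "g \<in> carrier ?F" for x g
    using M g
    by (induction g rule: monoid_algebra_induct)
      (use x s in \<open>simp_all add: h_zero F.r_distr B.r_distr h_add basis_elt_closed h_basis h_smult
        F.smult_mult_right B.smult_mult_right basis_elt_mult h_basis1 hom_mult s_cl h_cl\<close>)
  have h_mult: "h (f \<otimes>\<^bsub>?F\<^esub> g) = h f \<otimes>\<^bsub>B\<^esub> h g"
    if f: "f \<in> carrier ?F" and g: "g \<in> carrier ?F" for f g
    using M f
    by (induction f rule: monoid_algebra_induct)
      (use g in \<open>simp_all add: h_zero F.l_distr B.l_distr h_add basis_elt_closed h_basis h_smult
        F.smult_mult_left B.smult_mult_left h_mult_basis h_basis1 s_cl h_cl\<close>)
  have "h \<in> alg_hom ?F B"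
  proof (intro alg_homI ring_hom_memI)
    show "h \<one>\<^bsub>?F\<^esub> = \<one>\<^bsub>B\<^esub>" by (simp add: monoid_algebra_simps(2) h_basis1 s1)
    show "h \<in> extensional (carrier ?F)" by (simp add: h_def)
  qed (simp_all add: h_cl h_add h_mult h_smult)
  then show ?thesis using that h_basis1 by blast
qed

subsection \<open>The Clifford algebra\<close>

lemma assoc_real_algebra_clifford: "assoc_real_algebra (clifford r)"
  unfolding clifford_def
  by (intro assoc_real_algebra_quot_alg assoc_real_algebra_monoid_algebra monoid_free_monoid
      clifford_ideal)

text \<open>The classes of words span the algebra, and the class of a word is a product of
  generators; zero is reached as the multiple of the unit by the scalar 0.\<close>

lemma clifford_induct [consumes 1, case_names one gen add mult smult]:
  assumes x: "x \<in> carrier (clifford r)"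
    and one: "P \<one>\<^bsub>clifford r\<^esub>"
    and gen: "\<And>i. i < r \<Longrightarrow> P (clifford_gen r i)"
    and add: "\<And>x y. x \<in> carrier (clifford r) \<Longrightarrow> y \<in> carrier (clifford r) \<Longrightarrow> P x \<Longrightarrow> P y \<Longrightarrow>
      P (x \<oplus>\<^bsub>clifford r\<^esub> y)"
    and mult: "\<And>x y. x \<in> carrier (clifford r) \<Longrightarrow> y \<in> carrier (clifford r) \<Longrightarrow> P x \<Longrightarrow> P y \<Longrightarrow>
      P (x \<otimes>\<^bsub>clifford r\<^esub> y)"
    and smult: "\<And>c x. x \<in> carrier (clifford r) \<Longrightarrow> P x \<Longrightarrow> P (c \<odot>\<^bsub>clifford r\<^esub> x)"
  shows "P x"
proof -
  interpret C: assoc_real_algebra "clifford r" by (rule assoc_real_algebra_clifford)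
  let ?F = "free_alg r" and ?I = "clifford_ideal r"
  have F: "assoc_real_algebra ?F"
    by (rule assoc_real_algebra_monoid_algebra[OF monoid_free_monoid])
  interpret F: assoc_real_algebra ?F by (rule F)
  let ?\<pi> = "\<lambda>f. ?I +>\<^bsub>?F\<^esub> f"
  have hom: "?\<pi> \<in> Ring.ring_hom ?F (clifford r)"
    unfolding clifford_def by (rule quot_alg_proj[OF clifford_ideal])
  have sm: "?\<pi> (c \<odot>\<^bsub>?F\<^esub> f) = c \<odot>\<^bsub>clifford r\<^esub> ?\<pi> f" if "f \<in> carrier ?F" for c f
    unfolding clifford_def using quot_alg_proj_smult[OF F clifford_ideal that] by simp
  have basis: "basis_elt xs \<in> carrier ?F" if "xs \<in> lists {..<r}" for xs
    using that by (intro basis_elt_closed) (simp add: free_monoid_def)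
  have words: "P (?\<pi> (basis_elt xs))" if "xs \<in> lists {..<r}" for xs
    using that
  proof (induction xs)
    case Nil
    have "?\<pi> (basis_elt []) = \<one>\<^bsub>clifford r\<^esub>"
      using ring_hom_one[OF hom] by (simp add: monoid_algebra_simps free_monoid_def)
    then show ?case using one by simp
  next
    case (Cons i xs)
    have i: "[i] \<in> lists {..<r}" using Cons by simp
    have "basis_elt (i # xs) = basis_elt [i] \<otimes>\<^bsub>?F\<^esub> basis_elt xs"
      by (simp add: basis_elt_mult free_monoid_def)
    then have "?\<pi> (basis_elt (i # xs)) = clifford_gen r i \<otimes>\<^bsub>clifford r\<^esub> ?\<pi> (basis_elt xs)"
      using ring_hom_mult[OF hom basis[OF i] basis] Cons by (simp add: clifford_gen_def)
    then show ?case
      using mult[OF clifford_gen_closed ring_hom_closed[OF hom basis] gen] Cons by simp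
  qed
  obtain f where f: "f \<in> carrier ?F" "x = ?\<pi> f"
    using x unfolding clifford_def quot_alg_carrier[OF clifford_ideal] by blast
  have "P (?\<pi> f)" using monoid_free_monoid f(1)
  proof (induction f rule: monoid_algebra_induct)
    case zero
    have "?\<pi> \<zero>\<^bsub>?F\<^esub> = \<zero>\<^bsub>clifford r\<^esub>"
      using sm[of "\<one>\<^bsub>?F\<^esub>" 0] ring_hom_one[OF hom] by simp
    then show ?case using smult[OF C.one_closed one, of 0] by simp
  next
    case (add c xs f)
    then have xs: "xs \<in> lists {..<r}" by (simp add: free_monoid_def)
    then show ?case
      using add basis[OF xs] words[OF xs] assms(4)[OF _ _ smult add.IH]
      by (simp add: ring_hom_add[OF hom] sm ring_hom_closed[OF hom])
  qed
  then show ?thesis using f by simp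
qed

text \<open>Three extensions in a row: the family \<open>s\<close> extends to words by taking
  products, the resulting monoid map extends linearly to the free algebra, and \<open>square\<close>
  and \<open>anti\<close> say exactly that the Clifford relations go to 0, so the map descends to
  the quotient.\<close>

lemma clifford_lift:
  assumes B: "assoc_real_algebra B"
    and closed: "\<And>i. i < r \<Longrightarrow> s i \<in> carrier B"
    and square: "\<And>i. i < r \<Longrightarrow> s i \<otimes>\<^bsub>B\<^esub> s i = \<one>\<^bsub>B\<^esub>"
    and anti: "\<And>i j. i < r \<Longrightarrow> j < r \<Longrightarrow> i \<noteq> j \<Longrightarrow> s i \<otimes>\<^bsub>B\<^esub> s j \<oplus>\<^bsub>B\<^esub> s j \<otimes>\<^bsub>B\<^esub> s i = \<zero>\<^bsub>B\<^esub>"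
  obtains h where "h \<in> alg_hom (clifford r) B" and "\<And>i. i < r \<Longrightarrow> h (clifford_gen r i) = s i"
proof -
  interpret B: assoc_real_algebra B by fact
  let ?M = "free_monoid {..<r}" and ?F = "free_alg r"
  have F: "assoc_real_algebra ?F"
    by (rule assoc_real_algebra_monoid_algebra[OF monoid_free_monoid])
  interpret F: assoc_real_algebra ?F by (rule F)
  define t where "t xs = foldr (\<lambda>i y. s i \<otimes>\<^bsub>B\<^esub> y) xs \<one>\<^bsub>B\<^esub>" for xs
  have t_cl: "t xs \<in> carrier B" if "xs \<in> lists {..<r}" for xs
    using that by (induction xs) (simp_all add: t_def closed)
  have t_append: "t (xs @ ys) = t xs \<otimes>\<^bsub>B\<^esub> t ys" if "xs \<in> lists {..<r}" "ys \<in> lists {..<r}" for xs ys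
    using that(1)
  proof (induction xs)
    case Nil then show ?case using t_cl[OF that(2)] by (simp add: t_def)
  next
    case (Cons i xs)
    then show ?case using t_cl[OF that(2)] t_cl[of xs] closed[of i]
      by (simp add: t_def B.m_assoc)
  qed
  have "t \<in> hom ?M B" by (auto simp: hom_def free_monoid_def t_cl t_append)
  moreover have "t \<one>\<^bsub>?M\<^esub> = \<one>\<^bsub>B\<^esub>" by (simp add: t_def free_monoid_def)
  ultimately obtain g where g: "g \<in> alg_hom ?F B"
    and g_basis: "\<And>xs. xs \<in> carrier ?M \<Longrightarrow> g (basis_elt xs) = t xs"
    using monoid_algebra_lift[OF monoid_free_monoid B] by blast
  interpret g: ring_hom_ring ?F B g by (rule alg_hom_ring_hom_ring[OF F B g])
  have x: "basis_elt [i] \<in> carrier ?F" if "i < r" for i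
    using that by (intro basis_elt_closed) (simp add: free_monoid_def)
  have gx: "g (basis_elt [i]) = s i" if "i < r" for i
    using that closed g_basis[of "[i]"] by (simp add: free_monoid_def t_def)
  have rels: "clifford_rels r \<subseteq> carrier ?F"
    using clifford_rels_subset ideal.axioms(1)[OF clifford_ideal] additive_subgroup.a_subset by blast
  have "g y = \<zero>\<^bsub>B\<^esub>" if "y \<in> clifford_rels r" for y
    using that unfolding clifford_rels_def Let_def
    by (auto simp: a_minus_def x gx square anti B.r_neg)
  from quot_alg_lift[OF F B rels g this] obtain k where
    k: "k \<in> alg_hom (clifford r) B" "\<And>f. f \<in> carrier ?F \<Longrightarrow> k (clifford_ideal r +>\<^bsub>?F\<^esub> f) = g f"
    unfolding clifford_def clifford_ideal_def by blast
  show ?thesis using that[OF k(1)] k(2) x gx by (simp add: clifford_gen_def)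
qed

text \<open>The elements whose image commutes with \<open>y\<close> form a subalgebra, so it
  suffices that it contains the generators.\<close>

lemma alg_hom_clifford_commute:
  assumes B: "assoc_real_algebra B" and h: "h \<in> alg_hom (clifford r) B"
    and y: "y \<in> carrier B" and x: "x \<in> carrier (clifford r)"
    and gen: "\<And>i. i < r \<Longrightarrow> h (clifford_gen r i) \<otimes>\<^bsub>B\<^esub> y = y \<otimes>\<^bsub>B\<^esub> h (clifford_gen r i)"
  shows "h x \<otimes>\<^bsub>B\<^esub> y = y \<otimes>\<^bsub>B\<^esub> h x"
proof -
  interpret B: assoc_real_algebra B by fact
  show ?thesis using x
  proof (induction x rule: clifford_induct)
    case (mult u v)
    then have cl: "h u \<in> carrier B" "h v \<in> carrier B" using alg_homD(4)[OF h] by auto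
    have "h u \<otimes>\<^bsub>B\<^esub> h v \<otimes>\<^bsub>B\<^esub> y = h u \<otimes>\<^bsub>B\<^esub> y \<otimes>\<^bsub>B\<^esub> h v"
      using cl y mult by (metis B.m_assoc)
    also have "\<dots> = y \<otimes>\<^bsub>B\<^esub> (h u \<otimes>\<^bsub>B\<^esub> h v)" using cl y mult by (simp add: B.m_assoc)
    finally show ?case using mult by (simp add: alg_homD[OF h])
  qed (use y alg_homD(4)[OF h] gen in \<open>simp_all add: alg_homD[OF h] B.l_distr B.r_distr
      B.smult_mult_left B.smult_mult_right\<close>)
qed

subsection \<open>The tensor product\<close>

context
  fixes A :: "(real, 'a) module" and B :: "(real, 'b) module"
  assumes A: "assoc_real_algebra A" and B: "assoc_real_algebra B"
begin

interpretation A: assoc_real_algebra A by (rule A)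
interpretation B: assoc_real_algebra B by (rule B)

lemma monoid_DirProd_algebra: "monoid (A \<times>\<times> B)"
  by (intro DirProd_monoid A.monoid_axioms B.monoid_axioms)

interpretation F: assoc_real_algebra "monoid_algebra (A \<times>\<times> B)"
  by (rule assoc_real_algebra_monoid_algebra[OF monoid_DirProd_algebra])

lemma tensor_ideal_algebra:
  "ideal (tensor_ideal A B) (monoid_algebra (A \<times>\<times> B))" "tensor_rels A B \<subseteq> tensor_ideal A B"
  using tensor_ideal[OF A.ring_axioms B.ring_axioms] by auto

lemma assoc_real_algebra_tensor_alg: "assoc_real_algebra (tensor_alg A B)"
  unfolding tensor_alg_def
  by (rule assoc_real_algebra_quot_alg[OF F.assoc_real_algebra_axioms tensor_ideal_algebra(1)])

interpretation T: assoc_real_algebra "tensor_alg A B" by (rule assoc_real_algebra_tensor_alg)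

lemma tensor_proj:
  "(+>\<^bsub>monoid_algebra (A \<times>\<times> B)\<^esub>) (tensor_ideal A B)
    \<in> Ring.ring_hom (monoid_algebra (A \<times>\<times> B)) (tensor_alg A B)"
  unfolding tensor_alg_def by (rule quot_alg_proj[OF tensor_ideal_algebra(1)])

lemma tensor_proj_smult:
  "f \<in> carrier (monoid_algebra (A \<times>\<times> B)) \<Longrightarrow>
    tensor_ideal A B +>\<^bsub>monoid_algebra (A \<times>\<times> B)\<^esub> (c \<odot>\<^bsub>monoid_algebra (A \<times>\<times> B)\<^esub> f) =
    c \<odot>\<^bsub>tensor_alg A B\<^esub> (tensor_ideal A B +>\<^bsub>monoid_algebra (A \<times>\<times> B)\<^esub> f)"
  unfolding tensor_alg_def
  by (simp add: quot_alg_proj_smult[OF F.assoc_real_algebra_axioms tensor_ideal_algebra(1)])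

text \<open>Each element of \<open>tensor_rels\<close> is written as a difference, so every
  bilinearity rule for pure tensors below comes from a single relation through this
  criterion.\<close>

lemma tensor_proj_eq:
  assumes "x \<in> carrier (monoid_algebra (A \<times>\<times> B))" "y \<in> carrier (monoid_algebra (A \<times>\<times> B))"
    and "x \<ominus>\<^bsub>monoid_algebra (A \<times>\<times> B)\<^esub> y \<in> tensor_rels A B"
  shows "tensor_ideal A B +>\<^bsub>monoid_algebra (A \<times>\<times> B)\<^esub> x =
    tensor_ideal A B +>\<^bsub>monoid_algebra (A \<times>\<times> B)\<^esub> y"
  using assms tensor_ideal_algebra F.quotient_eq_iff_same_a_r_cos[OF tensor_ideal_algebra(1)] by blast

lemma basis_elt_DirProd_closed:
  "a \<in> carrier A \<Longrightarrow> b \<in> carrier B \<Longrightarrow> basis_elt (a, b) \<in> carrier (monoid_algebra (A \<times>\<times> B))"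
  by (intro basis_elt_closed) simp

section \<open>Calculus of pure tensors and the universal property\<close>

lemma pure_tensor_closed:
  "a \<in> carrier A \<Longrightarrow> b \<in> carrier B \<Longrightarrow> pure_tensor A B a b \<in> carrier (tensor_alg A B)"
  unfolding pure_tensor_def by (intro ring_hom_closed[OF tensor_proj] basis_elt_DirProd_closed)

lemma pure_tensor_one: "pure_tensor A B \<one>\<^bsub>A\<^esub> \<one>\<^bsub>B\<^esub> = \<one>\<^bsub>tensor_alg A B\<^esub>"
  using ring_hom_one[OF tensor_proj] by (simp add: pure_tensor_def monoid_algebra_simps)

lemma pure_tensor_mult:
  assumes "a \<in> carrier A" "b \<in> carrier B" "a' \<in> carrier A" "b' \<in> carrier B"
  shows "pure_tensor A B a b \<otimes>\<^bsub>tensor_alg A B\<^esub> pure_tensor A B a' b' =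
    pure_tensor A B (a \<otimes>\<^bsub>A\<^esub> a') (b \<otimes>\<^bsub>B\<^esub> b')"
  unfolding pure_tensor_def
  using assms by (simp add: basis_elt_DirProd_closed basis_elt_mult flip: ring_hom_mult[OF tensor_proj])

lemma pure_tensor_add_left:
  assumes "a \<in> carrier A" "a' \<in> carrier A" "b \<in> carrier B"
  shows "pure_tensor A B (a \<oplus>\<^bsub>A\<^esub> a') b = pure_tensor A B a b \<oplus>\<^bsub>tensor_alg A B\<^esub> pure_tensor A B a' b"
  unfolding pure_tensor_def
  using assms
  by (simp add: basis_elt_DirProd_closed flip: ring_hom_add[OF tensor_proj])
     (rule tensor_proj_eq; auto simp: basis_elt_DirProd_closed tensor_rels_def Let_def)

lemma pure_tensor_add_right:
  assumes "a \<in> carrier A" "b \<in> carrier B" "b' \<in> carrier B"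
  shows "pure_tensor A B a (b \<oplus>\<^bsub>B\<^esub> b') = pure_tensor A B a b \<oplus>\<^bsub>tensor_alg A B\<^esub> pure_tensor A B a b'"
  unfolding pure_tensor_def
  using assms
  by (simp add: basis_elt_DirProd_closed flip: ring_hom_add[OF tensor_proj])
     (rule tensor_proj_eq; auto simp: basis_elt_DirProd_closed tensor_rels_def Let_def)

lemma pure_tensor_smult_left:
  assumes "a \<in> carrier A" "b \<in> carrier B"
  shows "pure_tensor A B (c \<odot>\<^bsub>A\<^esub> a) b = c \<odot>\<^bsub>tensor_alg A B\<^esub> pure_tensor A B a b"
  unfolding pure_tensor_def
  using assms
  by (simp add: basis_elt_DirProd_closed flip: tensor_proj_smult)
     (rule tensor_proj_eq; auto simp: basis_elt_DirProd_closed tensor_rels_def Let_def)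

lemma pure_tensor_smult_right:
  assumes "a \<in> carrier A" "b \<in> carrier B"
  shows "pure_tensor A B a (c \<odot>\<^bsub>B\<^esub> b) = c \<odot>\<^bsub>tensor_alg A B\<^esub> pure_tensor A B a b"
  unfolding pure_tensor_def
  using assms
  by (simp add: basis_elt_DirProd_closed flip: tensor_proj_smult)
     (rule tensor_proj_eq; auto simp: basis_elt_DirProd_closed tensor_rels_def Let_def)

text \<open>Since \<open>a \<otimes> b = (a \<otimes> 1)(1 \<otimes> b)\<close>, the two embedded
  factors generate the tensor product as an algebra.\<close>

lemma tensor_alg_induct [consumes 1, case_names left right add mult smult]:
  assumes x: "x \<in> carrier (tensor_alg A B)"
    and left: "\<And>a. a \<in> carrier A \<Longrightarrow> P (pure_tensor A B a \<one>\<^bsub>B\<^esub>)"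
    and right: "\<And>b. b \<in> carrier B \<Longrightarrow> P (pure_tensor A B \<one>\<^bsub>A\<^esub> b)"
    and add: "\<And>x y. x \<in> carrier (tensor_alg A B) \<Longrightarrow> y \<in> carrier (tensor_alg A B) \<Longrightarrow> P x \<Longrightarrow> P y \<Longrightarrow>
      P (x \<oplus>\<^bsub>tensor_alg A B\<^esub> y)"
    and mult: "\<And>x y. x \<in> carrier (tensor_alg A B) \<Longrightarrow> y \<in> carrier (tensor_alg A B) \<Longrightarrow> P x \<Longrightarrow> P y \<Longrightarrow>
      P (x \<otimes>\<^bsub>tensor_alg A B\<^esub> y)"
    and smult: "\<And>c x. x \<in> carrier (tensor_alg A B) \<Longrightarrow> P x \<Longrightarrow> P (c \<odot>\<^bsub>tensor_alg A B\<^esub> x)"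
  shows "P x"
proof -
  let ?F = "monoid_algebra (A \<times>\<times> B)"
  let ?\<pi> = "\<lambda>f. tensor_ideal A B +>\<^bsub>?F\<^esub> f"
  have pure: "P (pure_tensor A B a b)" if "a \<in> carrier A" "b \<in> carrier B" for a b
    using that pure_tensor_mult[of a "\<one>\<^bsub>B\<^esub>" "\<one>\<^bsub>A\<^esub>" b]
      mult[of "pure_tensor A B a \<one>\<^bsub>B\<^esub>" "pure_tensor A B \<one>\<^bsub>A\<^esub> b"] left right
    by (simp add: pure_tensor_closed)
  obtain f where f: "f \<in> carrier ?F" "x = ?\<pi> f"
    using x unfolding tensor_alg_def quot_alg_carrier[OF tensor_ideal_algebra(1)] by blast
  have "P (?\<pi> f)" using monoid_DirProd_algebra f(1)
  proof (induction f rule: monoid_algebra_induct)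
    case zero
    have "?\<pi> \<zero>\<^bsub>?F\<^esub> = \<zero>\<^bsub>tensor_alg A B\<^esub>"
      using tensor_proj_smult[of "\<one>\<^bsub>?F\<^esub>" 0] ring_hom_one[OF tensor_proj] by simp
    then show ?case using smult[OF _ left[of "\<one>\<^bsub>A\<^esub>"], of 0] by (simp add: pure_tensor_closed)
  next
    case (add c z f)
    then obtain a b where z: "z = (a, b)" "a \<in> carrier A" "b \<in> carrier B" by auto
    then have "P (c \<odot>\<^bsub>tensor_alg A B\<^esub> pure_tensor A B a b \<oplus>\<^bsub>tensor_alg A B\<^esub> ?\<pi> f)"
      using add by (intro assms(4) smult pure T.smult_closed pure_tensor_closed
          ring_hom_closed[OF tensor_proj])
    then show ?case
      using add z basis_elt_DirProd_closed
      by (simp add: ring_hom_add[OF tensor_proj] tensor_proj_smult pure_tensor_def)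
  qed
  then show ?thesis using f by simp
qed

text \<open>Sending \<open>(a, b)\<close> to the product of \<open>f a\<close> and
  \<open>g b\<close> is linear in each variable, and commutation of the two images makes it
  multiplicative; so it extends to the monoid algebra and kills \<open>tensor_rels\<close>.\<close>

lemma tensor_alg_lift:
  assumes C: "assoc_real_algebra C" and f: "f \<in> alg_hom A C" and g: "g \<in> alg_hom B C"
    and comm: "\<And>a b. a \<in> carrier A \<Longrightarrow> b \<in> carrier B \<Longrightarrow> f a \<otimes>\<^bsub>C\<^esub> g b = g b \<otimes>\<^bsub>C\<^esub> f a"
  obtains h where "h \<in> alg_hom (tensor_alg A B) C"
    and "\<And>a b. a \<in> carrier A \<Longrightarrow> b \<in> carrier B \<Longrightarrow> h (pure_tensor A B a b) = f a \<otimes>\<^bsub>C\<^esub> g b"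
proof -
  interpret C: assoc_real_algebra C by fact
  let ?F = "monoid_algebra (A \<times>\<times> B)"
  define t where "t = (\<lambda>(a, b). f a \<otimes>\<^bsub>C\<^esub> g b)"
  \<comment> \<open>Commutation enters here, to interchange the two middle factors
    \<open>f a'\<close> and \<open>g b\<close>.\<close>
  have t_mult: "(f a \<otimes>\<^bsub>C\<^esub> f a') \<otimes>\<^bsub>C\<^esub> (g b \<otimes>\<^bsub>C\<^esub> g b') = (f a \<otimes>\<^bsub>C\<^esub> g b) \<otimes>\<^bsub>C\<^esub> (f a' \<otimes>\<^bsub>C\<^esub> g b')"
    if ab: "a \<in> carrier A" "a' \<in> carrier A" "b \<in> carrier B" "b' \<in> carrier B" for a a' b b'
  proof -
    note cl = alg_homD(4)[OF f ab(1)] alg_homD(4)[OF f ab(2)] alg_homD(4)[OF g ab(3)] alg_homD(4)[OF g ab(4)]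
    have "(f a \<otimes>\<^bsub>C\<^esub> f a') \<otimes>\<^bsub>C\<^esub> (g b \<otimes>\<^bsub>C\<^esub> g b') = f a \<otimes>\<^bsub>C\<^esub> (f a' \<otimes>\<^bsub>C\<^esub> g b) \<otimes>\<^bsub>C\<^esub> g b'"
      using cl by (simp add: C.m_assoc)
    also have "\<dots> = f a \<otimes>\<^bsub>C\<^esub> (g b \<otimes>\<^bsub>C\<^esub> f a') \<otimes>\<^bsub>C\<^esub> g b'" using comm ab by simp
    finally show ?thesis using cl by (simp add: C.m_assoc)
  qed
  have "t \<in> hom (A \<times>\<times> B) C"
    by (auto simp: hom_def t_def alg_homD[OF f] alg_homD[OF g] t_mult)
  moreover have "t \<one>\<^bsub>A \<times>\<times> B\<^esub> = \<one>\<^bsub>C\<^esub>" by (simp add: t_def alg_homD[OF f] alg_homD[OF g])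
  ultimately obtain k where k: "k \<in> alg_hom ?F C"
    and k_basis: "\<And>x. x \<in> carrier (A \<times>\<times> B) \<Longrightarrow> k (basis_elt x) = t x"
    using monoid_algebra_lift[OF monoid_DirProd_algebra C] by blast
  interpret k: ring_hom_ring ?F C k
    by (rule alg_hom_ring_hom_ring[OF F.assoc_real_algebra_axioms C k])
  have kb: "k (basis_elt (a, b)) = f a \<otimes>\<^bsub>C\<^esub> g b" if "a \<in> carrier A" "b \<in> carrier B" for a b
    using k_basis[of "(a, b)"] that by (simp add: t_def)
  have rels: "tensor_rels A B \<subseteq> carrier ?F"
    using tensor_ideal_algebra(2) ideal.axioms(1)[OF tensor_ideal_algebra(1)] additive_subgroup.a_subset
    by blast
  have "k y = \<zero>\<^bsub>C\<^esub>" if "y \<in> tensor_rels A B" for y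
    using that unfolding tensor_rels_def Let_def
    by (auto simp: a_minus_def basis_elt_DirProd_closed kb alg_homD(3)[OF k] alg_homD[OF f] alg_homD[OF g]
        C.l_distr C.r_distr C.smult_mult_left C.smult_mult_right C.r_neg)
  from quot_alg_lift[OF F.assoc_real_algebra_axioms C rels k this] obtain h where
    "h \<in> alg_hom (tensor_alg A B) C" "\<And>x. x \<in> carrier ?F \<Longrightarrow> h (tensor_ideal A B +>\<^bsub>?F\<^esub> x) = k x"
    unfolding tensor_alg_def tensor_ideal_def by blast
  then show ?thesis using that[of h] kb by (simp add: pure_tensor_def basis_elt_DirProd_closed)
qed

end


subsection \<open>The algebra \<open>C\<^sub>p \<otimes> C\<^sub>q\<close>\<close>

text \<open>These are the defining relations of \<open>C_p \<otimes> C_q\<close>; commutation across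
  the blocks reflects the ungraded tensor product. The algebra is a parameter so that the predicate
  applies both to \<open>gen\<close> and to families of matrices.\<close>

definition clifford_pair :: "(real, 'a) module \<Rightarrow> nat \<Rightarrow> nat \<Rightarrow> (nat \<Rightarrow> 'a) \<Rightarrow> bool" where
  "clifford_pair B p q s \<longleftrightarrow>
     (\<forall>i<p+q. s i \<in> carrier B \<and> s i \<otimes>\<^bsub>B\<^esub> s i = \<one>\<^bsub>B\<^esub>) \<and>
     (\<forall>i<p+q. \<forall>j<p+q. i \<noteq> j \<longrightarrow>
        (if (i < p) = (j < p) then s i \<otimes>\<^bsub>B\<^esub> s j \<oplus>\<^bsub>B\<^esub> s j \<otimes>\<^bsub>B\<^esub> s i = \<zero>\<^bsub>B\<^esub>
         else s i \<otimes>\<^bsub>B\<^esub> s j = s j \<otimes>\<^bsub>B\<^esub> s i))"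

lemma assoc_real_algebra_CC: "assoc_real_algebra (CC p q)"
  unfolding CC_def
  by (rule assoc_real_algebra_tensor_alg[OF assoc_real_algebra_clifford assoc_real_algebra_clifford])

lemmas CC_pure_tensor_simps =
  pure_tensor_closed[OF assoc_real_algebra_clifford assoc_real_algebra_clifford, folded CC_def]
  pure_tensor_one[OF assoc_real_algebra_clifford assoc_real_algebra_clifford, folded CC_def]
  pure_tensor_mult[OF assoc_real_algebra_clifford assoc_real_algebra_clifford, folded CC_def]
  pure_tensor_add_left[OF assoc_real_algebra_clifford assoc_real_algebra_clifford, folded CC_def]
  pure_tensor_add_right[OF assoc_real_algebra_clifford assoc_real_algebra_clifford, folded CC_def]
  pure_tensor_smult_left[OF assoc_real_algebra_clifford assoc_real_algebra_clifford, folded CC_def]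
  pure_tensor_smult_right[OF assoc_real_algebra_clifford assoc_real_algebra_clifford, folded CC_def]

lemma clifford_pair_gen: "clifford_pair (CC p q) p q (gen p q)"
proof -
  interpret C: assoc_real_algebra "clifford p" by (rule assoc_real_algebra_clifford)
  interpret D: assoc_real_algebra "clifford q" by (rule assoc_real_algebra_clifford)
  interpret T: assoc_real_algebra "CC p q" by (rule assoc_real_algebra_CC)
  \<comment> \<open>A zero factor is 0 times the unit, and the scalar moves out of the tensor. This
    turns an anticommutator that vanishes in one factor into 0 in \<open>CC p q\<close>.\<close>
  have "pure_tensor (clifford p) (clifford q) \<zero>\<^bsub>clifford p\<^esub> \<one>\<^bsub>clifford q\<^esub> = \<zero>\<^bsub>CC p q\<^esub>"
    "pure_tensor (clifford p) (clifford q) \<one>\<^bsub>clifford p\<^esub> \<zero>\<^bsub>clifford q\<^esub> = \<zero>\<^bsub>CC p q\<^esub>"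
    using CC_pure_tensor_simps(6)[of "\<one>\<^bsub>clifford p\<^esub>" p "\<one>\<^bsub>clifford q\<^esub>" q 0]
      CC_pure_tensor_simps(7)[of "\<one>\<^bsub>clifford p\<^esub>" p "\<one>\<^bsub>clifford q\<^esub>" q 0]
    by (simp_all add: CC_pure_tensor_simps(1,2))
  then show ?thesis
    by (auto simp: clifford_pair_def gen_def clifford_gen_closed clifford_gen_square
        clifford_gen_anticommute CC_pure_tensor_simps(1-3)
        simp flip: CC_pure_tensor_simps(4,5))
qed

lemma clifford_pair_alg_hom:
  assumes A: "assoc_real_algebra A" and B: "assoc_real_algebra B" and h: "h \<in> alg_hom A B"
    and s: "clifford_pair A p q s"
  shows "clifford_pair B p q (\<lambda>i. h (s i))"
proof -
  interpret h: ring_hom_ring A B h by (rule alg_hom_ring_hom_ring[OF A B h])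
  interpret A: assoc_real_algebra A by (rule A)
  have cl: "s i \<in> carrier A" if "i < p + q" for i using s that by (auto simp: clifford_pair_def)
  show ?thesis
    unfolding clifford_pair_def
  proof (intro conjI allI impI)
    fix i assume i: "i < p + q"
    then show "h (s i) \<in> carrier B" using cl by simp
    have "s i \<otimes>\<^bsub>A\<^esub> s i = \<one>\<^bsub>A\<^esub>" using s i by (simp add: clifford_pair_def)
    then show "h (s i) \<otimes>\<^bsub>B\<^esub> h (s i) = \<one>\<^bsub>B\<^esub>" using cl[OF i] by (simp flip: h.hom_mult)
  next
    fix i j assume ij: "i < p + q" "j < p + q" "i \<noteq> j"
    then have "if (i < p) = (j < p) then s i \<otimes>\<^bsub>A\<^esub> s j \<oplus>\<^bsub>A\<^esub> s j \<otimes>\<^bsub>A\<^esub> s i = \<zero>\<^bsub>A\<^esub>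
        else s i \<otimes>\<^bsub>A\<^esub> s j = s j \<otimes>\<^bsub>A\<^esub> s i" using s by (simp add: clifford_pair_def)
    then show "if (i < p) = (j < p)
        then h (s i) \<otimes>\<^bsub>B\<^esub> h (s j) \<oplus>\<^bsub>B\<^esub> h (s j) \<otimes>\<^bsub>B\<^esub> h (s i) = \<zero>\<^bsub>B\<^esub>
        else h (s i) \<otimes>\<^bsub>B\<^esub> h (s j) = h (s j) \<otimes>\<^bsub>B\<^esub> h (s i)"
      using cl[OF ij(1)] cl[OF ij(2)] by (simp split: if_splits flip: h.hom_mult h.hom_add)
  qed
qed

text \<open>Two layers of generation: the embedded factors generate the tensor product, and each
  embedding respects the operations, so induction over a Clifford algebra reduces its factor to
  generators.\<close>

lemma CC_induct [consumes 1, case_names one gen add mult smult]: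
  assumes x: "x \<in> carrier (CC p q)"
    and one: "P \<one>\<^bsub>CC p q\<^esub>"
    and gen: "\<And>i. i < p + q \<Longrightarrow> P (gen p q i)"
    and add: "\<And>x y. x \<in> carrier (CC p q) \<Longrightarrow> y \<in> carrier (CC p q) \<Longrightarrow> P x \<Longrightarrow> P y \<Longrightarrow> P (x \<oplus>\<^bsub>CC p q\<^esub> y)"
    and mult: "\<And>x y. x \<in> carrier (CC p q) \<Longrightarrow> y \<in> carrier (CC p q) \<Longrightarrow> P x \<Longrightarrow> P y \<Longrightarrow> P (x \<otimes>\<^bsub>CC p q\<^esub> y)"
    and smult: "\<And>c x. x \<in> carrier (CC p q) \<Longrightarrow> P x \<Longrightarrow> P (c \<odot>\<^bsub>CC p q\<^esub> x)"
  shows "P x"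
proof -
  interpret C: assoc_real_algebra "clifford p" by (rule assoc_real_algebra_clifford)
  interpret D: assoc_real_algebra "clifford q" by (rule assoc_real_algebra_clifford)
  note s = CC_pure_tensor_simps
  show ?thesis
    using x unfolding CC_def
  proof (induction x rule: tensor_alg_induct[OF assoc_real_algebra_clifford assoc_real_algebra_clifford,
        consumes 1, case_names left right add mult smult])
    case (left a)
    then show ?case
    proof (induction a rule: clifford_induct)
      case (gen i)
      then show ?case using assms(3)[of i] by (simp add: gen_def)
    next
      case (mult a b)
      have "pure_tensor (clifford p) (clifford q) (a \<otimes>\<^bsub>clifford p\<^esub> b) \<one>\<^bsub>clifford q\<^esub> =
          pure_tensor (clifford p) (clifford q) a \<one>\<^bsub>clifford q\<^esub> \<otimes>\<^bsub>CC p q\<^esub>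
          pure_tensor (clifford p) (clifford q) b \<one>\<^bsub>clifford q\<^esub>" using mult by (simp add: s(3))
      then show ?case using mult assms(5) by (simp add: s(1))
    qed (use one assms(4,6) in \<open>simp_all add: s(1,2,4,6)\<close>)
  next
    case (right a)
    then show ?case
    proof (induction a rule: clifford_induct)
      case (gen i)
      then show ?case using assms(3)[of "p + i"] by (simp add: gen_def)
    next
      case (mult a b)
      have "pure_tensor (clifford p) (clifford q) \<one>\<^bsub>clifford p\<^esub> (a \<otimes>\<^bsub>clifford q\<^esub> b) =
          pure_tensor (clifford p) (clifford q) \<one>\<^bsub>clifford p\<^esub> a \<otimes>\<^bsub>CC p q\<^esub>
          pure_tensor (clifford p) (clifford q) \<one>\<^bsub>clifford p\<^esub> b" using mult by (simp add: s(3))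
      then show ?case using mult assms(5) by (simp add: s(1))
    qed (use one assms(4,6) in \<open>simp_all add: s(1,2,5,7)\<close>)
  qed (use assms(4-6) in \<open>simp_all flip: CC_def\<close>)
qed

text \<open>Uniqueness half of the universal property: the elements where \<open>h\<close> and
  \<open>k\<close> agree form a subalgebra containing the generators. Extensionality turns agreement
  on the carrier into equality.\<close>

lemma CC_alg_hom_eqI:
  assumes h: "h \<in> alg_hom (CC p q) B" and k: "k \<in> alg_hom (CC p q) B"
    and gen: "\<And>i. i < p + q \<Longrightarrow> h (gen p q i) = k (gen p q i)"
  shows "h = k"
proof (rule extensionalityI[OF alg_homD(2)[OF h] alg_homD(2)[OF k]])
  show "h x = k x" if "x \<in> carrier (CC p q)" for x
    using that
    by (induction x rule: CC_induct) (simp_all add: gen alg_homD[OF h] alg_homD[OF k])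
qed

text \<open>Existence half of the universal property: each block of \<open>s\<close> lifts to one
  Clifford factor, and the two lifts combine because their images commute.\<close>

lemma CC_lift:
  assumes B: "assoc_real_algebra B" and s: "clifford_pair B p q s"
  obtains h where "h \<in> alg_hom (CC p q) B" and "\<And>i. i < p + q \<Longrightarrow> h (gen p q i) = s i"
proof -
  interpret B: assoc_real_algebra B by (rule B)
  interpret C: assoc_real_algebra "clifford p" by (rule assoc_real_algebra_clifford)
  interpret D: assoc_real_algebra "clifford q" by (rule assoc_real_algebra_clifford)
  have cl: "s i \<in> carrier B" "s i \<otimes>\<^bsub>B\<^esub> s i = \<one>\<^bsub>B\<^esub>" if "i < p + q" for i
    using s that by (auto simp: clifford_pair_def)
  have anti: "s i \<otimes>\<^bsub>B\<^esub> s j \<oplus>\<^bsub>B\<^esub> s j \<otimes>\<^bsub>B\<^esub> s i = \<zero>\<^bsub>B\<^esub>"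
    if "i < p + q" "j < p + q" "i \<noteq> j" "(i < p) = (j < p)" for i j
    using s that by (simp add: clifford_pair_def)
  have comm: "s i \<otimes>\<^bsub>B\<^esub> s (p + j) = s (p + j) \<otimes>\<^bsub>B\<^esub> s i" if "i < p" "j < q" for i j
  proof -
    have "if (i < p) = (p + j < p)
        then s i \<otimes>\<^bsub>B\<^esub> s (p + j) \<oplus>\<^bsub>B\<^esub> s (p + j) \<otimes>\<^bsub>B\<^esub> s i = \<zero>\<^bsub>B\<^esub>
        else s i \<otimes>\<^bsub>B\<^esub> s (p + j) = s (p + j) \<otimes>\<^bsub>B\<^esub> s i"
      using s that unfolding clifford_pair_def by simp
    then show ?thesis using that by simp
  qed
  obtain f where f: "f \<in> alg_hom (clifford p) B" "\<And>i. i < p \<Longrightarrow> f (clifford_gen p i) = s i"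
    by (rule clifford_lift[OF B, of p s]) (auto simp: cl anti)
  obtain g where g: "g \<in> alg_hom (clifford q) B" "\<And>i. i < q \<Longrightarrow> g (clifford_gen q i) = s (p + i)"
    by (rule clifford_lift[OF B, of q "\<lambda>i. s (p + i)"]) (auto simp: cl anti)
  \<comment> \<open>Commutation spreads from generators in two stages: first to all of the first
    factor against a fixed generator of the second, then, with \<open>f a\<close> held fixed, to all
    of the second factor.\<close>
  have fs: "f a \<otimes>\<^bsub>B\<^esub> s (p + j) = s (p + j) \<otimes>\<^bsub>B\<^esub> f a" if "a \<in> carrier (clifford p)" "j < q" for a j
    by (rule alg_hom_clifford_commute[OF B f(1) _ that(1)]) (simp_all add: f(2) cl comm that)
  have fg: "f a \<otimes>\<^bsub>B\<^esub> g b = g b \<otimes>\<^bsub>B\<^esub> f a"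
    if "a \<in> carrier (clifford p)" "b \<in> carrier (clifford q)" for a b
    by (rule alg_hom_clifford_commute[OF B g(1) _ that(2), symmetric])
      (simp_all add: g(2) alg_homD(4)[OF f(1)] fs that)
  obtain h where h: "h \<in> alg_hom (CC p q) B"
    "\<And>a b. a \<in> carrier (clifford p) \<Longrightarrow> b \<in> carrier (clifford q) \<Longrightarrow>
      h (pure_tensor (clifford p) (clifford q) a b) = f a \<otimes>\<^bsub>B\<^esub> g b"
    by (rule tensor_alg_lift[OF assoc_real_algebra_clifford assoc_real_algebra_clifford B f(1) g(1) fg,
        folded CC_def]) (assumption, assumption, rule that, assumption, simp)
  have "h (gen p q i) = s i" if i: "i < p + q" for i
  proof (cases "i < p")
    case True
    then show ?thesis
      using h(2)[OF clifford_gen_closed[OF True] D.one_closed] i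
      by (simp add: gen_def alg_homD(7)[OF g(1)] f(2) cl(1))
  next
    case False
    then have "i - p < q" using i by simp
    then show ?thesis
      using h(2)[OF C.one_closed clifford_gen_closed] i False
      by (simp add: gen_def alg_homD(7)[OF f(1)] g(2) cl(1))
  qed
  then show ?thesis by (rule that[OF h(1)])
qed

subsection \<open>Self-duality as Clifford relations\<close>

lemma assoc_real_algebra_module_mat: "assoc_real_algebra (module_mat TYPE(real) m m)"
proof (intro assoc_real_algebra.intro assoc_real_algebra_axioms.intro)
  show "ring (module_mat TYPE(real) m m)"
    by (intro ringI abelian_group_mat monoidI)
      (auto simp: module_mat_simps add_mult_distrib_mat mult_add_distrib_mat)
qed (auto simp: module_mat_simps add_smult_distrib_right_mat add_smult_distrib_left_mat
    mult_smult_distrib mult_smult_assoc_mat intro!: eq_matI)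

section \<open>The signature of \<open>P\<close> and products of linear combinations in
  coordinates\<close>

abbreviation sig :: "nat \<Rightarrow> nat \<Rightarrow> real" where
  "sig p i \<equiv> if i < p then 1 else -1"

lemma Pform_eq_sum: "Pform p q v = (\<Sum>i<p+q. sig p i * (v $ i)\<^sup>2)"
proof -
  have "(\<Sum>i<p+k. sig p i * (v $ i)\<^sup>2) = (\<Sum>i<p. (v $ i)\<^sup>2) - (\<Sum>j<k. (v $ (p + j))\<^sup>2)" for k
    by (induction k) simp_all
  then show ?thesis by (simp add: Pform_def)
qed

lemma lin_comb_mult_index:
  assumes S: "\<And>i. i < n \<Longrightarrow> S i \<in> carrier_mat m m" and ab: "a < m" "b < m"
  shows "(lin_comb n m S v * lin_comb n m S w) $$ (a, b) =
    (\<Sum>i<n. \<Sum>j<n. v $ i * w $ j * (S i * S j) $$ (a, b))"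
proof -
  have "(lin_comb n m S v * lin_comb n m S w) $$ (a, b) =
      (\<Sum>k<m. (\<Sum>i<n. v $ i * S i $$ (a, k)) * (\<Sum>j<n. w $ j * S j $$ (k, b)))"
    using ab by (simp add: lin_comb_def scalar_prod_def atLeast0LessThan)
  also have "\<dots> = (\<Sum>k<m. \<Sum>i<n. \<Sum>j<n. v $ i * w $ j * (S i $$ (a, k) * S j $$ (k, b)))"
    by (simp add: sum_product mult_ac)
  also have "\<dots> = (\<Sum>i<n. \<Sum>j<n. \<Sum>k<m. v $ i * w $ j * (S i $$ (a, k) * S j $$ (k, b)))"
    by (subst sum.swap, rule sum.cong[OF refl], subst sum.swap, rule refl)
  also have "\<dots> = (\<Sum>i<n. \<Sum>j<n. v $ i * w $ j * (S i * S j) $$ (a, b))"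
  proof (intro sum.cong refl)
    fix i j assume "i \<in> {..<n}" "j \<in> {..<n}"
    then have c: "S i \<in> carrier_mat m m" "S j \<in> carrier_mat m m" using S by auto
    then have "(S i * S j) $$ (a, b) = (\<Sum>k<m. S i $$ (a, k) * S j $$ (k, b))"
      using ab by (simp add: scalar_prod_def atLeast0LessThan)
    then show "(\<Sum>k<m. v $ i * w $ j * (S i $$ (a, k) * S j $$ (k, b))) =
        v $ i * w $ j * (S i * S j) $$ (a, b)" by (simp add: sum_distrib_left)
  qed
  finally show ?thesis .
qed

text \<open>Symmetrizing \<open>S(v) S(\<phi>(v))\<close> in the two summation indices produces exactly this
  uniform shape of the relations, with \<open>sig\<close> the signature of \<open>P\<close>.\<close>

lemma clifford_pair_mat_iff:
  assumes S: "\<And>i. i < p + q \<Longrightarrow> S i \<in> carrier_mat m m"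
  shows "clifford_pair (module_mat TYPE(real) m m) p q S \<longleftrightarrow>
    (\<forall>i<p+q. \<forall>j<p+q. \<forall>a<m. \<forall>b<m.
      sig p j * (S i * S j) $$ (a, b) + sig p i * (S j * S i) $$ (a, b) =
      (if i = j \<and> a = b then 2 * sig p i else 0))" (is "?L \<longleftrightarrow> ?R")
proof -
  let ?N = "\<lambda>i j. \<forall>a<m. \<forall>b<m.
    sig p j * (S i * S j) $$ (a, b) + sig p i * (S j * S i) $$ (a, b) =
    (if i = j \<and> a = b then 2 * sig p i else 0)"
  have split: "(\<forall>i<n. \<forall>j<n. N i j) \<longleftrightarrow> (\<forall>i<n. N i i) \<and> (\<forall>i<n. \<forall>j<n. i \<noteq> j \<longrightarrow> N i j)"
    for N :: "nat \<Rightarrow> nat \<Rightarrow> bool" and n by metis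
  have entries: "A = B \<longleftrightarrow> (\<forall>a<m. \<forall>b<m. A $$ (a, b) = B $$ (a, b))"
    if "A \<in> carrier_mat m m" "B \<in> carrier_mat m m" for A B :: "real mat"
    using that by (auto intro!: eq_matI)
  \<comment> \<open>For \<open>i = j\<close> both terms coincide, and the common factor
    \<open>2 * sig p i\<close> cancels.\<close>
  have diag: "S i * S i = 1\<^sub>m m \<longleftrightarrow> ?N i i" if "i < p + q" for i
    using S[OF that] by (subst entries) (auto simp del: index_mult_mat)
  \<comment> \<open>Within a block the signs agree and \<open>?N\<close> concerns
    \<open>sig p i\<close> times the anticommutator; across blocks the signs are opposite and it
    concerns, up to sign, the commutator.\<close>
  have off: "(if (i < p) = (j < p) then S i * S j + S j * S i = 0\<^sub>m m m else S i * S j = S j * S i) \<longleftrightarrow>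
      ?N i j" if "i < p + q" "j < p + q" "i \<noteq> j" for i j
  proof -
    have c: "S i \<in> carrier_mat m m" "S j \<in> carrier_mat m m"
      "S i * S j + S j * S i \<in> carrier_mat m m" "S i * S j \<in> carrier_mat m m" "S j * S i \<in> carrier_mat m m"
      using S[OF that(1)] S[OF that(2)] by auto
    have add: "(S i * S j + S j * S i) $$ (a, b) = (S i * S j) $$ (a, b) + (S j * S i) $$ (a, b)"
      if "a < m" "b < m" for a b using c that by (simp del: index_mult_mat(1))
    show ?thesis
      unfolding entries[OF c(3) zero_carrier_mat] entries[OF c(4,5)]
      using that(3) by (auto simp: add neg_eq_iff_add_eq_0 simp del: index_mult_mat(1) index_add_mat)
  qed
  have "?L \<longleftrightarrow> (\<forall>i<p+q. S i * S i = 1\<^sub>m m) \<and> (\<forall>i<p+q. \<forall>j<p+q. i \<noteq> j \<longrightarrow>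
      (if (i < p) = (j < p) then S i * S j + S j * S i = 0\<^sub>m m m else S i * S j = S j * S i))"
    unfolding clifford_pair_def module_mat_simps using S by blast
  also have "\<dots> \<longleftrightarrow> (\<forall>i<p+q. ?N i i) \<and> (\<forall>i<p+q. \<forall>j<p+q. i \<noteq> j \<longrightarrow> ?N i j)"
    by (intro arg_cong2[of _ _ _ _ "(\<and>)"] all_cong imp_cong refl) (rule diag off; assumption)+
  also have "\<dots> \<longleftrightarrow> ?R" by (rule split[symmetric])
  finally show ?thesis .
qed

text \<open>Coordinate \<open>j\<close> of \<open>phi p q v\<close> is
  \<open>sig p j * v $ j / Pform p q v\<close>. Adding the resulting double sum to its copy with the
  indices interchanged symmetrizes the coefficients and produces the factor 2. Where
  \<open>Pform p q v\<close> is 0 both sides are 0, since \<open>x / 0 = 0\<close>.\<close>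

lemma lin_comb_mult_phi_index:
  assumes S: "\<And>i. i < p + q \<Longrightarrow> S i \<in> carrier_mat m m" and ab: "a < m" "b < m"
  shows "2 * (lin_comb (p + q) m S v * lin_comb (p + q) m S (phi p q v)) $$ (a, b) =
    (\<Sum>i<p+q. \<Sum>j<p+q. v $ i * v $ j *
      (sig p j * (S i * S j) $$ (a, b) + sig p i * (S j * S i) $$ (a, b))) / Pform p q v"
proof -
  let ?M = "\<lambda>i j. v $ i * v $ j * (sig p j * (S i * S j) $$ (a, b)) / Pform p q v"
  have "(lin_comb (p + q) m S v * lin_comb (p + q) m S (phi p q v)) $$ (a, b) =
      (\<Sum>i<p+q. \<Sum>j<p+q. ?M i j)"
    by (subst lin_comb_mult_index[OF S ab]) (auto simp: phi_def intro!: sum.cong)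
  moreover have "(\<Sum>i<p+q. \<Sum>j<p+q. ?M i j) = (\<Sum>i<p+q. \<Sum>j<p+q. ?M j i)" by (rule sum.swap)
  ultimately have "2 * (lin_comb (p + q) m S v * lin_comb (p + q) m S (phi p q v)) $$ (a, b) =
      (\<Sum>i<p+q. \<Sum>j<p+q. ?M i j + ?M j i)" by (simp only: sum.distrib)
  also have "\<dots> = (\<Sum>i<p+q. \<Sum>j<p+q. v $ i * v $ j *
      (sig p j * (S i * S j) $$ (a, b) + sig p i * (S j * S i) $$ (a, b)) / Pform p q v)"
    by (intro sum.cong refl) (simp only: distrib_left add_divide_distrib mult_ac)
  finally show ?thesis by (simp only: sum_divide_distrib)
qed

text \<open>Multiplying an entry of the matrix equation by \<open>2 * Pform p q v\<close> leaves an
  equality of quadratic polynomials in \<open>v\<close>, and \<open>clifford_pair\<close> equates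
  their symmetrized coefficients. \<open>Omega\<close> contains enough points to recover these from
  the values.\<close>

lemma self_dual_iff_clifford_pair:
  assumes S: "\<And>i. i < p + q \<Longrightarrow> S i \<in> carrier_mat m m"
  shows "(\<forall>v\<in>Omega p q. lin_comb (p + q) m S v * lin_comb (p + q) m S (phi p q v) = 1\<^sub>m m) \<longleftrightarrow>
    clifford_pair (module_mat TYPE(real) m m) p q S" (is "?L \<longleftrightarrow> ?R")
proof -
  let ?N = "\<lambda>a b i j. sig p j * (S i * S j) $$ (a, b) + sig p i * (S j * S i) $$ (a, b)"
  have point: "lin_comb (p + q) m S v * lin_comb (p + q) m S (phi p q v) = 1\<^sub>m m \<longleftrightarrow>
      (\<forall>a<m. \<forall>b<m. (\<Sum>i<p+q. \<Sum>j<p+q. v $ i * v $ j * ?N a b i j) =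
        (if a = b then 2 * Pform p q v else 0))" if v: "v \<in> Omega p q" for v
  proof -
    let ?X = "lin_comb (p + q) m S v * lin_comb (p + q) m S (phi p q v)"
    have X: "?X \<in> carrier_mat m m" by (auto simp: lin_comb_def)
    have nz: "Pform p q v \<noteq> 0" using v by (simp add: Omega_def)
    have "?X = 1\<^sub>m m \<longleftrightarrow> (\<forall>a<m. \<forall>b<m. ?X $$ (a, b) = (if a = b then 1 else 0))"
      using X by (auto intro!: eq_matI simp del: index_mult_mat(1))
    also have "\<dots> \<longleftrightarrow> (\<forall>a<m. \<forall>b<m. (\<Sum>i<p+q. \<Sum>j<p+q. v $ i * v $ j * ?N a b i j) =
        (if a = b then 2 * Pform p q v else 0))"
    proof (intro all_cong)
      fix a b assume ab: "a < m" "b < m"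
      have "2 * ?X $$ (a, b) * Pform p q v = (\<Sum>i<p+q. \<Sum>j<p+q. v $ i * v $ j * ?N a b i j)"
        using nz by (subst lin_comb_mult_phi_index[OF S ab]) simp_all
      then show "?X $$ (a, b) = (if a = b then 1 else 0) \<longleftrightarrow>
          (\<Sum>i<p+q. \<Sum>j<p+q. v $ i * v $ j * ?N a b i j) = (if a = b then 2 * Pform p q v else 0)"
        using nz by (cases "a = b") (auto simp del: index_mult_mat(1))
    qed
    finally show ?thesis .
  qed
  show ?thesis
  proof
    assume ?R
    then have N: "?N a b i j = (if i = j \<and> a = b then 2 * sig p i else 0)"
      if "a < m" "b < m" "i < p + q" "j < p + q" for a b i j
      using clifford_pair_mat_iff[of p q S, OF S] that by blast
    have "(\<Sum>i<p+q. \<Sum>j<p+q. v $ i * v $ j * ?N a b i j) = (if a = b then 2 * Pform p q v else 0)"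
      if ab: "a < m" "b < m" for a b and v :: "real vec"
    proof -
      \<comment> \<open>Only the terms with \<open>i = j\<close> survive; they add up to
        \<open>2 * Pform p q v\<close> if \<open>a = b\<close> and vanish otherwise.\<close>
      have "(\<Sum>i<p+q. \<Sum>j<p+q. v $ i * v $ j * ?N a b i j) =
          (\<Sum>i<p+q. \<Sum>j<p+q. if i = j then (if a = b then 2 * (sig p i * (v $ i)\<^sup>2) else 0) else 0)"
        by (intro sum.cong refl, subst N[OF ab]) (auto simp: power2_eq_square)
      also have "\<dots> = (if a = b then 2 * Pform p q v else 0)"
        by (simp add: Pform_eq_sum sum_distrib_left)
      finally show ?thesis .
    qed
    then show ?L using point by blast
  next
    assume L: ?L
    have eq: "(\<Sum>i<p+q. \<Sum>j<p+q. v $ i * v $ j * ?N a b i j) = (if a = b then 2 * Pform p q v else 0)"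
      if "v \<in> Omega p q" "a < m" "b < m" for v a b
      using L point that by blast
    have sum2: "(\<Sum>k<p+q. f k) = f i + f j"
      if "i < p + q" "j < p + q" "i \<noteq> j" "\<And>k. k \<noteq> i \<Longrightarrow> k \<noteq> j \<Longrightarrow> f k = 0" for f :: "nat \<Rightarrow> real" and i j
    proof -
      have "(\<Sum>k<p+q. f k) = sum f {i, j}" using that by (intro sum.mono_neutral_right) auto
      then show ?thesis using that by simp
    qed
    have sum1: "(\<Sum>k<p+q. f k) = f i"
      if "i < p + q" "\<And>k. k \<noteq> i \<Longrightarrow> f k = 0" for f :: "nat \<Rightarrow> real" and i
    proof -
      have "(\<Sum>k<p+q. f k) = sum f {i}" using that by (intro sum.mono_neutral_right) auto
      then show ?thesis by simp
    qed
    have diag: "?N a b i i = (if a = b then 2 * sig p i else 0)" if "a < m" "b < m" "i < p + q" for a b i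
    proof -
      \<comment> \<open>\<open>P\<close> takes the value 1 or -1 at the standard basis vector, which
        therefore lies in \<open>Omega\<close>; there only the coefficient at \<open>(i, i)\<close>
        contributes.\<close>
      define v where "v = (vec (p + q) (\<lambda>k. if k = i then 1 else 0) :: real vec)"
      have "Pform p q v = sig p i"
        unfolding Pform_eq_sum
        by (subst sum.cong[OF refl, of _ _ "\<lambda>k. if k = i then sig p k else 0"])
           (use that in \<open>auto simp: v_def\<close>)
      moreover from this have "v \<in> Omega p q" by (auto simp: Omega_def v_def)
      ultimately have "(\<Sum>k<p+q. \<Sum>l<p+q. v $ k * v $ l * ?N a b k l) = (if a = b then 2 * sig p i else 0)"
        using eq[of v a b] that by simp
      also have "(\<Sum>k<p+q. \<Sum>l<p+q. v $ k * v $ l * ?N a b k l) =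
          (\<Sum>k<p+q. \<Sum>l<p+q. (if k = i then 1 else 0) * (if l = i then 1 else 0) * ?N a b k l)"
        by (intro sum.cong refl) (simp add: v_def del: index_mult_mat)
      also have "\<dots> = ?N a b i i"
        by (subst sum1[OF that(3)], simp, subst sum1[OF that(3)]) simp_all
      finally show ?thesis .
    qed
    have off: "?N a b i j = 0" if ab: "a < m" "b < m" and ij: "i < p + q" "j < p + q" "i \<noteq> j" for a b i j
    proof -
      \<comment> \<open>With the weight 2, \<open>P\<close> does not vanish at \<open>2 e\<^sub>i + e\<^sub>j\<close>, even when \<open>i\<close> and \<open>j\<close> have opposite signs.\<close>
      let ?c = "\<lambda>k. if k = i then 2 else if k = j then 1 else 0 :: real"
      define v where "v = vec (p + q) ?c"
      have "Pform p q v = (\<Sum>k<p+q. sig p k * (?c k)\<^sup>2)"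
        unfolding Pform_eq_sum by (intro sum.cong refl) (simp add: v_def)
      also have "\<dots> = 4 * sig p i + sig p j"
        using ij(3) by (subst sum2[OF ij]) auto
      finally have P: "Pform p q v = 4 * sig p i + sig p j" .
      then have "v \<in> Omega p q" by (auto simp: Omega_def v_def)
      then have "(\<Sum>k<p+q. \<Sum>l<p+q. v $ k * v $ l * ?N a b k l) =
          (if a = b then 2 * (4 * sig p i + sig p j) else 0)"
        using eq[of v a b] ab unfolding P by blast
      also have "(\<Sum>k<p+q. \<Sum>l<p+q. v $ k * v $ l * ?N a b k l) =
          (\<Sum>k<p+q. \<Sum>l<p+q. ?c k * ?c l * ?N a b k l)"
        by (intro sum.cong refl) (simp add: v_def del: index_mult_mat)
      also have "\<dots> = 4 * ?N a b i i + 2 * ?N a b i j + (2 * ?N a b j i + ?N a b j j)"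
        using ij(3)
        by (subst sum2[OF ij], simp, subst (1 2) sum2[OF ij]) (simp_all del: index_mult_mat)
      \<comment> \<open>The coefficient is symmetric in \<open>i\<close> and \<open>j\<close>, so
        the two mixed terms give 4 times the sought value, while the diagonal terms already account
        for the right-hand side.\<close>
      finally show ?thesis
        unfolding diag[OF ab ij(1)] diag[OF ab ij(2)] by (cases "a = b"; cases "i < p"; cases "j < p"; simp del: index_mult_mat)
    qed
    have "\<forall>i<p+q. \<forall>j<p+q. \<forall>a<m. \<forall>b<m. ?N a b i j = (if i = j \<and> a = b then 2 * sig p i else 0)"
    proof (intro allI impI)
      fix i j a b assume *: "i < p + q" "j < p + q" "a < m" "b < m"
      show "?N a b i j = (if i = j \<and> a = b then 2 * sig p i else 0)"
        using diag[OF *(3,4,1)] off[OF *(3,4,1,2)] by (cases "i = j") (simp_all del: index_mult_mat)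
    qed
    then show ?R using clifford_pair_mat_iff[of p q S, OF S] by blast
  qed
qed

subsection \<open>The correspondence\<close>

text \<open>Linearity, applied along initial segments \<open>{..<k}\<close> of the sum. The formula
  transfers the symmetry condition on \<open>V\<close> to the images of the generators.\<close>

lemma alg_hom_embed_V:
  assumes h: "\<rho> \<in> alg_hom (CC p q) (module_mat TYPE(real) m m)"
  shows "\<rho> (embed_V p q v) = lin_comb (p + q) m (\<lambda>i. \<rho> (gen p q i)) v"
proof -
  interpret C: assoc_real_algebra "CC p q" by (rule assoc_real_algebra_CC)
  interpret h: ring_hom_ring "CC p q" "module_mat TYPE(real) m m" \<rho>
    by (rule alg_hom_ring_hom_ring[OF assoc_real_algebra_CC assoc_real_algebra_module_mat h])
  have g: "gen p q i \<in> carrier (CC p q)" if "i < p + q" for i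
    using clifford_pair_gen that by (simp add: clifford_pair_def)
  have "\<rho> (\<Oplus>\<^bsub>CC p q\<^esub>i\<in>{..<k}. (v $ i) \<odot>\<^bsub>CC p q\<^esub> gen p q i) = lin_comb k m (\<lambda>i. \<rho> (gen p q i)) v"
    if "k \<le> p + q" for k
    using that
  proof (induction k)
    case 0
    show ?case by (auto simp: module_mat_simps lin_comb_def)
  next
    case (Suc k)
    have c: "\<rho> (gen p q k) \<in> carrier_mat m m"
      using alg_homD(4)[OF h g[of k]] Suc.prems by (simp add: module_mat_simps)
    have "\<rho> (\<Oplus>\<^bsub>CC p q\<^esub>i\<in>{..<Suc k}. (v $ i) \<odot>\<^bsub>CC p q\<^esub> gen p q i) =
        \<rho> ((v $ k) \<odot>\<^bsub>CC p q\<^esub> gen p q k) + lin_comb k m (\<lambda>i. \<rho> (gen p q i)) v"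
      using Suc g by (simp add: lessThan_Suc C.finsum_closed Pi_def module_mat_simps)
    also have "\<dots> = v $ k \<cdot>\<^sub>m \<rho> (gen p q k) + lin_comb k m (\<lambda>i. \<rho> (gen p q i)) v"
      using Suc.prems g by (simp add: alg_homD(3)[OF h] module_mat_simps)
    also have "\<dots> = lin_comb (Suc k) m (\<lambda>i. \<rho> (gen p q i)) v"
      using c by (intro eq_matI) (auto simp: lin_comb_def)
    finally show ?case .
  qed
  then show ?thesis by (simp add: embed_V_def)
qed

section \<open>Symmetry of the image of \<open>V\<close>\<close>

lemma lin_comb_unit_vec:
  assumes "i < n" "S i \<in> carrier_mat m m"
  shows "lin_comb n m S (unit_vec n i) = S i"
proof (rule eq_matI)
  fix a b assume ab: "a < dim_row (S i)" "b < dim_col (S i)"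
  have "(\<Sum>k<n. unit_vec n i $ k * S k $$ (a, b)) = (\<Sum>k<n. if k = i then S k $$ (a, b) else 0)"
    using assms by (intro sum.cong) auto
  then show "lin_comb n m S (unit_vec n i) $$ (a, b) = S i $$ (a, b)"
    using ab assms by (simp add: lin_comb_def)
qed (use assms in \<open>simp_all add: lin_comb_def\<close>)

lemma lin_comb_Sym:
  assumes "\<And>i. i < n \<Longrightarrow> S i \<in> Sym m"
  shows "lin_comb n m S v \<in> Sym m"
proof -
  have "S i $$ (b, a) = S i $$ (a, b)" if "i < n" "a < m" "b < m" for i a b
    using assms[OF that(1)] that by (auto simp: Sym_def) (metis carrier_matD index_transpose_mat(1))
  then show ?thesis
    by (auto simp: Sym_def lin_comb_def intro!: eq_matI sum.cong)
qed

text \<open>Symmetric matrices form a linear subspace, which gives one direction; the unit vectors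
  of \<open>V\<close> recover the generators, which gives the other.\<close>

lemma sym_reps_iff:
  "\<rho> \<in> sym_reps p q m \<longleftrightarrow>
    \<rho> \<in> alg_hom (CC p q) (module_mat TYPE(real) m m) \<and> (\<forall>i<p+q. \<rho> (gen p q i) \<in> Sym m)"
proof (cases "\<rho> \<in> alg_hom (CC p q) (module_mat TYPE(real) m m)")
  case True
  have c: "\<rho> (gen p q i) \<in> carrier_mat m m" if "i < p + q" for i
    using clifford_pair_gen that alg_homD(4)[OF True] by (simp add: clifford_pair_def module_mat_simps)
  have "(\<forall>v\<in>carrier_vec (p + q). lin_comb (p + q) m (\<lambda>i. \<rho> (gen p q i)) v \<in> Sym m) \<longleftrightarrow>
      (\<forall>i<p+q. \<rho> (gen p q i) \<in> Sym m)"
  proof (intro iffI allI ballI impI)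
    fix i assume *: "\<forall>v\<in>carrier_vec (p + q). lin_comb (p + q) m (\<lambda>i. \<rho> (gen p q i)) v \<in> Sym m"
      and i: "i < p + q"
    show "\<rho> (gen p q i) \<in> Sym m"
      using bspec[OF *, of "unit_vec (p + q) i"] lin_comb_unit_vec[OF i, of "\<lambda>i. \<rho> (gen p q i)"] c[OF i]
      by simp
  qed (rule lin_comb_Sym, blast)
  then show ?thesis using True by (simp add: sym_reps_def alg_hom_embed_V image_subset_iff)
qed (simp add: sym_reps_def)

theorem theorem2p2:
  fixes p q m :: nat
  assumes "p + q \<ge> 1"
  shows "bij_betw (\<lambda>\<rho>. quad_map (p + q) m (\<lambda>i. \<rho> (gen p q i)))
           (sym_reps p q m)
           {Q \<in> quadratic_mappings (p + q) m. self_dual p q m Q}"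
proof (rule bij_betw_imageI)
  let ?M = "module_mat TYPE(real) m m"
  let ?\<Phi> = "\<lambda>\<rho>. quad_map (p + q) m (\<lambda>i. \<rho> (gen p q i))"
  have self_dual: "self_dual p q m (quad_map (p + q) m S) \<longleftrightarrow> clifford_pair ?M p q S"
    if S: "\<forall>i<p+q. S i \<in> Sym m" for S
  proof -
    have c: "S i \<in> carrier_mat m m" if "i < p + q" for i using S that by (simp add: Sym_def)
    \<comment> \<open>The family named by the existential in \<open>self_dual\<close> may differ
      from \<open>S\<close>, but polarization forces agreement below \<open>p + q\<close>, and
      \<open>lin_comb\<close> sees only those indices.\<close>
    have "lin_comb (p + q) m T = lin_comb (p + q) m S"
      if "\<forall>i<p+q. T i \<in> Sym m" "quad_map (p + q) m S = quad_map (p + q) m T" for T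
      using quad_map_inject[OF S that] by (auto simp: lin_comb_def fun_eq_iff intro!: cong_mat)
    then have "self_dual p q m (quad_map (p + q) m S) \<longleftrightarrow>
        (\<forall>v\<in>Omega p q. lin_comb (p + q) m S v * lin_comb (p + q) m S (phi p q v) = 1\<^sub>m m)"
      unfolding self_dual_def using S by metis
    also have "\<dots> \<longleftrightarrow> clifford_pair ?M p q S" by (rule self_dual_iff_clifford_pair) (rule c)
    finally show ?thesis .
  qed
  show "inj_on ?\<Phi> (sym_reps p q m)"
  proof (rule inj_onI)
    fix \<rho> \<sigma> assume "\<rho> \<in> sym_reps p q m" "\<sigma> \<in> sym_reps p q m" and eq: "?\<Phi> \<rho> = ?\<Phi> \<sigma>"
    then have hom: "\<rho> \<in> alg_hom (CC p q) ?M" "\<sigma> \<in> alg_hom (CC p q) ?M"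
      and sym: "\<forall>i<p+q. \<rho> (gen p q i) \<in> Sym m" "\<forall>i<p+q. \<sigma> (gen p q i) \<in> Sym m"
      unfolding sym_reps_iff by blast+
    \<comment> \<open>Polarization recovers the images of the generators from the quadratic mapping,
      and these determine the homomorphism.\<close>
    show "\<rho> = \<sigma>"
      by (rule CC_alg_hom_eqI[OF hom]) (rule quad_map_inject[OF sym eq])
  qed
  show "?\<Phi> ` sym_reps p q m = {Q \<in> quadratic_mappings (p + q) m. self_dual p q m Q}"
  proof (intro equalityI subsetI)
    fix Q assume "Q \<in> ?\<Phi> ` sym_reps p q m"
    then obtain \<rho> where \<rho>: "\<rho> \<in> alg_hom (CC p q) ?M" "\<forall>i<p+q. \<rho> (gen p q i) \<in> Sym m" "Q = ?\<Phi> \<rho>"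
      by (auto simp: sym_reps_iff)
    have "clifford_pair ?M p q (\<lambda>i. \<rho> (gen p q i))"
      by (rule clifford_pair_alg_hom[OF assoc_real_algebra_CC assoc_real_algebra_module_mat \<rho>(1)
          clifford_pair_gen])
    then have "self_dual p q m Q" unfolding \<rho>(3) self_dual[OF \<rho>(2)] .
    then show "Q \<in> {Q \<in> quadratic_mappings (p + q) m. self_dual p q m Q}"
      using \<rho>(2,3) by (auto simp: quadratic_mappings_def)
  next
    fix Q assume "Q \<in> {Q \<in> quadratic_mappings (p + q) m. self_dual p q m Q}"
    then obtain S where S: "\<forall>i<p+q. S i \<in> Sym m" "Q = quad_map (p + q) m S" "self_dual p q m Q"
      by (auto simp: quadratic_mappings_def)
    then have pair: "clifford_pair ?M p q S" using self_dual by blast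
    obtain \<rho> where \<rho>: "\<rho> \<in> alg_hom (CC p q) ?M" "\<And>i. i < p + q \<Longrightarrow> \<rho> (gen p q i) = S i"
      by (rule CC_lift[OF assoc_real_algebra_module_mat pair]) (rule that, assumption, simp)
    \<comment> \<open>The lift agrees with \<open>S\<close> below \<open>p + q\<close>, and
      \<open>quad_map\<close> evaluates only those indices.\<close>
    have "?\<Phi> \<rho> = Q" unfolding S(2) quad_map_def by (intro restrict_ext eq_vecI) (simp_all add: \<rho>(2))
    then show "Q \<in> ?\<Phi> ` sym_reps p q m" using \<rho> S(1) by (auto simp: sym_reps_iff)
  qed
qed

end
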